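(* Let $p_{-1},p_1,p_{-1,1}\ge0$ with $p_{-1}+p_1+p_{-1,1}=1$. Let $D^+(0,1;t)$ be the weighted generating function of Dyck N-excursions and $D^+(0,0;t)$ that of Dyck N-meanders whose set of reachable points is $\{0\}$ (with $t$ marking length). Let $$F(u,t)=\frac{1}{1-u\left(1-\frac1{D^+(0,0;t)}\right)}\cdot\frac{D^+(0,1;t)}{D^+(0,0;t)},$$ the generating function of Dyck N-excursions with $u$ marking the number of returns to zero (times the set of reachable points equals $\{0\}$). Define $Y_n$ by $\mathbb P(Y_n=k)=\frac{[t^{2n}u^k]F(u,t)}{[t^{2n}]D^+(0,1;t)}$. Then $Y_n$ admits a discrete limit distribution given by $$\mathbb P(Y_n=k)\to\begin{cases}\frac1{D^+(0,0;1)}\left(1-\frac1{D^+(0,0;1)}\right)^k & \text{if }0\le p_1\le p_{-1}<\frac12,\\ (1-p_{-1})p_{-1}^k & \text{if }0\le p_{-1}<\frac12,\ p_1=\frac12,\\ \frac{1}{2^{k+1}} & \text{if }0\le p_1<\frac12,\ p_{-1}=\frac12,\\ \frac{k}{2^{k+1}} & \text{if }p_1+p_{-1}=1,\\ \frac1{D^+(0,0;\rho_2)}\left(1-\frac1{D^+(0,0;\rho_2)}\right)^k & \text{if }0\le p_{-1}<\frac12<p_1<1,\ p_{-1}+p_1<1,\\ \frac{1+\eta^{k-1}}{2^{k+1}} & \text{if }0\le p_1<\frac12<p_{-1}<1,\ p_{-1}+p_1<1,\end{cases}$$ where $\rho_2=\frac1{4p_1(1-p_1)}$ and $\eta=\frac{p_{-1}(p_{-1}-p_1)-\sqrt{p_{-1}(1-p_{-1})(1-p_1-p_{-1})(p_{-1}-p_1)}}{p_{-1}(1-p_1)}\in[0,1]$;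 these are of geometric, negative binomial, or mixed type.
   Context: An N-step is a non-empty finite set of integers. Dyck N-walks are finite sequences $(s_1,\dots,s_n)$ of N-steps from $\{\{-1\},\{1\},\{-1,1\}\}$, starting at $0$; N-step $s$ has weight $p_s$ and a walk's weight is the product. A classical walk $(v_1,\dots,v_n)$ with positions $\omega_k=\sum_{i\le k}v_i$ is compatible if $v_i\in s_i$ for all $i$; it is a meander if all $\omega_k\ge0$, an excursion if moreover $\omega_n=0$. An N-meander (resp. N-excursion) is an N-walk compatible with at least one meander (resp. excursion); its reachable points are the endpoints of all compatible meanders.
   Formalization: In the last case the limit is (1+η(k−1))/2^{k+1}, since the printed (1+η^{k−1})/2^{k+1} exceeds 1 at k=0; in the fifth, D^+(0,0;t) is taken at t=√ρ_2, since at t=ρ_2 it can diverge; (p_{-1},p_1)=(1,0),(0,1), where Y_n is undefined, are excluded. *)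

theory Defs
  imports
    "HOL-Analysis.FPS_Convergence"
    "HOL-Probability.Probability_Mass_Function"
begin

type_synonym N_walk = "int set list"

definition dyck_N_walks :: "nat \<Rightarrow> N_walk set" where
  "dyck_N_walks n = {s. set s \<subseteq> {{-1}, {1}, {-1, 1}} \<and> length s = n}"

definition weight :: "(int set \<Rightarrow> real) \<Rightarrow> N_walk \<Rightarrow> real" where
  "weight p s = prod_list (map p s)"

(* A classical walk is the list v of its steps; its k-th position is sum_list (take k v). *)

definition compatible :: "int list \<Rightarrow> N_walk \<Rightarrow> bool" where
  "compatible v s \<longleftrightarrow> list_all2 (\<in>) v s"

definition meander :: "int list \<Rightarrow> bool" where
  "meander v \<longleftrightarrow> (\<forall>k\<le>length v. 0 \<le> sum_list (take k v))"

definition excursion :: "int list \<Rightarrow> bool" where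
  "excursion v \<longleftrightarrow> meander v \<and> sum_list v = 0"

definition N_meander :: "N_walk \<Rightarrow> bool" where
  "N_meander s \<longleftrightarrow> (\<exists>v. compatible v s \<and> meander v)"

definition N_excursion :: "N_walk \<Rightarrow> bool" where
  "N_excursion s \<longleftrightarrow> (\<exists>v. compatible v s \<and> excursion v)"

definition reachable :: "N_walk \<Rightarrow> int set" where
  "reachable s = {sum_list v |v. compatible v s \<and> meander v}"

definition returns :: "N_walk \<Rightarrow> nat" where
  "returns s = card {j \<in> {1..length s}. reachable (take j s) = {0}}"

(* In D^+(x,y;t) the variables x and y mark the minimal and the maximal reachable point, and
   t marks the length.  Hence D01 is D^+(0,1;t) and D00 is D^+(0,0;t). *)

definition D01 :: "(int set \<Rightarrow> real) \<Rightarrow> real fps" where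
  "D01 p = Abs_fps (\<lambda>n. \<Sum>s \<in> {s \<in> dyck_N_walks n. N_excursion s}. weight p s)"

definition D00 :: "(int set \<Rightarrow> real) \<Rightarrow> real fps" where
  "D00 p = Abs_fps (\<lambda>n. \<Sum>s \<in> {s \<in> dyck_N_walks n. N_meander s \<and> reachable s = {0}}. weight p s)"

(* F(u,t) is a power series in u whose coefficients are power series in t: the outer fps_X is u,
   and [t^n u^k] F is fps_nth (fps_nth F k) n. *)

definition F_gf :: "(int set \<Rightarrow> real) \<Rightarrow> real fps fps" where
  "F_gf p = 1 / (1 - fps_X * fps_const (1 - 1 / D00 p)) * fps_const (D01 p / D00 p)"

(* This is the dominant singularity of D01 in the variable t^2, not t (only even powers of t
   occur), so the corresponding value of t is sqrt (\<rho>\<^sub>2 p). *)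

definition \<rho>\<^sub>2 :: "(int set \<Rightarrow> real) \<Rightarrow> real" where
  "\<rho>\<^sub>2 p = 1 / (4 * p {1} * (1 - p {1}))"

definition \<eta> :: "(int set \<Rightarrow> real) \<Rightarrow> real" where
  "\<eta> p = (p {-1} * (p {-1} - p {1})
          - sqrt (p {-1} * (1 - p {-1}) * (1 - p {1} - p {-1}) * (p {-1} - p {1})))
        / (p {-1} * (1 - p {1}))"

end

(* Write a, b for the weights of {-1}, {1} and put z = t^2.  Let P be D^+(0,0) as a power series in
   z, let W = 1 - 1/P = a (1 - a) z P, and let H be the series of first returns to 0 of the minimal
   reachable point (walks that die being continued).  These are expressed by the Catalan series at
   a (1 - a) and b (1 - b), excursions satisfy (1 - H) E = 1 - a H P, and [u^k] F = W^k (1 - W) E.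
   The identity 1 - z = (1 - H) (1 - b H / (1 - b)) turns the quotient into
   (1 - z) E = N := (1 - a H P) (1 - b H / (1 - b)), so the coefficients of E and of W^k (1 - W) E
   are partial sums.  If N(1) is not 0 they converge, to N(1) and to W(1)^k (1 - W(1)) N(1).
   If N(1) = 0 they are tails, and both are compared with those of the scaled Catalan numbers
   sigma^n C_n / 4^n of order sigma^n n^(-3/2), where 1 / sigma is the smaller of the singularities
   of P and H: to be asymptotically a multiple of this sequence is a property stable under products,
   with the factors given by the Leibniz rule.  For a + b = 1 one has E = P, and the Leibniz rule
   applies directly. *)

theory Submission
  imports Defs
begin

section \<open>Reachable sets as states of an automaton\<close>

text \<open>A return to 0 involves both ends of the reachable set, but the two ends almost decouple.
  The maximum falls under \<open>{-1}\<close> and rises under the other steps, whatever the minimum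
  is; the walk dies exactly when \<open>{-1}\<close> is applied at maximum 0. A positive minimum
  falls with weight 1 - b and rises with weight b, and sees the maximum only at that death. So two
  one-dimensional walks suffice, which is why exactly two Catalan series occur. For b <= 1/2 one has
  H(1) = 1, so the denominator of E = (1 - a H P) / (1 - H) vanishes at z = 1. Multiplying by 1 - z
  turns the division into a product, and real values and coefficient limits then replace complex
  singularity analysis. The mixing constant is eta = 1 - 1 / (2 a h), where h is the value of H at
  the singularity of P. The last law is linear in k - 1: (1 + eta (k - 1)) / 2^(k + 1) has total
  mass 1, whereas a power eta^(k - 1) with 0 < eta <= 1 in that place would give more than
  1.\<close>

definition ladder :: "nat \<Rightarrow> nat \<Rightarrow> int set" where
  "ladder m d = (\<lambda>i. int m + 2 * int i) ` {..d}"

text \<open>The state \<open>Some (m, d, r)\<close> stands for the reachable set \<open>{m, m + 2, \<dots>, m + 2 * d}\<close>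
  after \<open>r\<close> returns, and \<open>None\<close> for an empty reachable set.\<close>

definition step :: "(nat \<times> nat \<times> nat) option \<Rightarrow> int set \<Rightarrow> (nat \<times> nat \<times> nat) option" where
  "step \<sigma> x = (case \<sigma> of None \<Rightarrow> None | Some (m, d, r) \<Rightarrow>
     if x = {1} then Some (m + 1, d, r)
     else if x = {-1} then
       (if m > 0 then Some (m - 1, d, if m = 1 \<and> d = 0 then r + 1 else r)
        else if d > 0 then Some (1, d - 1, r) else None)
     else (if m > 0 then Some (m - 1, d + 1, r) else Some (1, d, r)))"

definition state :: "N_walk \<Rightarrow> (nat \<times> nat \<times> nat) option" where
  "state s = foldl step (Some (0, 0, 0)) s"

lemma state_Nil [simp]: "state [] = Some (0, 0, 0)"
  and state_snoc [simp]: "state (s @ [x]) = step (state s) x"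
  by (simp_all add: state_def)

lemma compatible_snoc:
  "compatible v (s @ [x]) \<longleftrightarrow> (\<exists>v' w. v = v' @ [w] \<and> compatible v' s \<and> w \<in> x)"
proof
  assume "compatible v (s @ [x])"
  then show "\<exists>v' w. v = v' @ [w] \<and> compatible v' s \<and> w \<in> x"
    by (auto simp: compatible_def list_all2_append2 list_all2_Cons2)
qed (auto simp: compatible_def intro: list_all2_appendI)

lemma meander_snoc: "meander (v @ [w]) \<longleftrightarrow> meander v \<and> 0 \<le> sum_list v + w"
  by (auto simp: meander_def le_Suc_eq)

lemma reachable_Nil [simp]: "reachable [] = {0}"
  by (auto simp: reachable_def compatible_def meander_def)

lemma reachable_snoc:
  "reachable (s @ [x]) = {r + w |r w. r \<in> reachable s \<and> w \<in> x \<and> 0 \<le> r + w}"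
proof (intro equalityI subsetI)
  fix y assume "y \<in> reachable (s @ [x])"
  then obtain v w where "y = sum_list (v @ [w])" "compatible v s" "w \<in> x" "meander (v @ [w])"
    unfolding reachable_def compatible_snoc by blast
  then show "y \<in> {r + w |r w. r \<in> reachable s \<and> w \<in> x \<and> 0 \<le> r + w}"
    unfolding meander_snoc reachable_def by auto
next
  fix y assume "y \<in> {r + w |r w. r \<in> reachable s \<and> w \<in> x \<and> 0 \<le> r + w}"
  then obtain v w where "y = sum_list v + w" "compatible v s" "w \<in> x" "meander v" "0 \<le> sum_list v + w"
    unfolding reachable_def by blast
  then show "y \<in> reachable (s @ [x])"
    unfolding reachable_def compatible_snoc
    by (intro CollectI exI[of _ "v @ [w]"]) (auto simp: meander_snoc)
qed

lemma returns_snoc: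
  "returns (s @ [x]) = returns s + (if reachable (s @ [x]) = {0} then 1 else 0)"
proof -
  have single: "{j \<in> {c}. Q j} = (if Q c then {c} else {})" for Q and c :: nat by auto
  have tk: "take j (s @ [x]) = take j s" if "j \<le> length s" for j
    using that by simp
  have "{j \<in> {1..length (s @ [x])}. reachable (take j (s @ [x])) = {0}}
      = {j \<in> {1..length s}. reachable (take j (s @ [x])) = {0}}
        \<union> {j \<in> {Suc (length s)}. reachable (take j (s @ [x])) = {0}}"
    by (simp only: length_append_singleton) (use le_Suc_eq in fastforce)
  also have "{j \<in> {1..length s}. reachable (take j (s @ [x])) = {0}}
      = {j \<in> {1..length s}. reachable (take j s) = {0}}"
    by (intro Collect_cong conj_cong refl) (simp only: atLeastAtMost_iff tk)
  also have "{j \<in> {Suc (length s)}. reachable (take j (s @ [x])) = {0}}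
      = (if reachable (s @ [x]) = {0} then {Suc (length s)} else {})"
    unfolding single by simp
  finally show ?thesis
    unfolding returns_def by (simp add: card_insert_if)
qed

lemma ladder_eq_0_iff: "ladder m d = {0} \<longleftrightarrow> m = 0 \<and> d = 0"
proof
  assume "ladder m d = {0}"
  moreover have "int m \<in> ladder m d" "int m + 2 * int d \<in> ladder m d"
    by (auto simp: ladder_def image_iff intro: bexI[of _ 0])
  ultimately show "m = 0 \<and> d = 0" by auto
qed (auto simp: ladder_def)

lemma zero_in_ladder_iff: "0 \<in> ladder m d \<longleftrightarrow> m = 0"
  by (auto simp: ladder_def image_iff)

lemma mem_ladder_iff:
  "x \<in> ladder m d \<longleftrightarrow> int m \<le> x \<and> x \<le> int m + 2 * int d \<and> even (x - int m)"
proof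
  assume "int m \<le> x \<and> x \<le> int m + 2 * int d \<and> even (x - int m)"
  moreover then obtain k where k: "x - int m = 2 * k" by (meson dvdE)
  ultimately have "0 \<le> k" "k \<le> int d" by linarith+
  with k have "x = int m + 2 * int (nat k)" "nat k \<in> {..d}" by auto
  then show "x \<in> ladder m d" unfolding ladder_def by blast
qed (auto simp: ladder_def)

lemma state_correct:
  assumes "set s \<subseteq> {{-1}, {1}, {-1, 1}}"
  shows "case state s of None \<Rightarrow> reachable s = {}
         | Some (m, d, r) \<Rightarrow> reachable s = ladder m d \<and> returns s = r"
  using assms
proof (induction s rule: rev_induct)
  case Nil
  then show ?case by (auto simp: ladder_def returns_def)
next
  case (snoc x s)
  have x: "x = {-1} \<or> x = {1} \<or> x = {-1, 1}" using snoc.prems by auto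
  have pm: "({-1, 1} :: int set) \<noteq> {1}" "({-1, 1} :: int set) \<noteq> {-1}" by auto
  show ?case
  proof (cases "state s")
    case None
    then have "reachable s = {}" using snoc by simp
    then show ?thesis using None by (simp add: step_def reachable_snoc)
  next
    case (Some \<tau>)
    obtain m d r where \<tau>: "\<tau> = (m, d, r)" by (cases \<tau>)
    have IH: "reachable s = ladder m d" "returns s = r" using snoc Some \<tau> by auto
    have st: "state s = Some (m, d, r)" using Some \<tau> by simp
    have R: "reachable (s @ [x]) = (\<Union>w\<in>x. {y. y - w \<in> ladder m d \<and> 0 \<le> y})"
      unfolding reachable_snoc IH by (force simp: algebra_simps)
    have up: "{y. y - 1 \<in> ladder m d \<and> 0 \<le> y} = ladder (m + 1) d"
      by (auto simp: mem_ladder_iff)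
    \<comment> \<open>Under \<open>{-1}\<close> the point 0 is lost, so from m = 0 the smallest
      survivor is 2, which moves to 1.\<close>
    have down: "{y. y - (-1) \<in> ladder m d \<and> 0 \<le> y} =
        (if m > 0 then ladder (m - 1) d else if d > 0 then ladder 1 (d - 1) else {})"
      by (auto simp: mem_ladder_iff of_nat_diff) presburger+
    consider "x = {1}" | "x = {-1}" | "x = {-1, 1}" using x by blast
    then show ?thesis
    proof cases
      case 1
      then have "reachable (s @ [x]) = ladder (m + 1) d" using R up by simp
      then show ?thesis using 1 by (simp add: st step_def returns_snoc IH ladder_eq_0_iff)
    next
      case 2
      then have "reachable (s @ [x]) =
          (if m > 0 then ladder (m - 1) d else if d > 0 then ladder 1 (d - 1) else {})"
        using R down by simp
      then show ?thesis using 2 by (auto simp: st step_def returns_snoc IH ladder_eq_0_iff)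
    next
      case 3
      have "reachable (s @ [x]) = (if m > 0 then ladder (m - 1) (d + 1) else ladder 1 d)"
      proof -
        have "reachable (s @ [x])
            = {y. y - 1 \<in> ladder m d \<and> 0 \<le> y} \<union> {y. y - (-1) \<in> ladder m d \<and> 0 \<le> y}"
          unfolding R unfolding 3 by auto
        also have "\<dots> = ladder (m + 1) d
            \<union> (if m > 0 then ladder (m - 1) d else if d > 0 then ladder 1 (d - 1) else {})"
          unfolding up down ..
        finally have "reachable (s @ [x]) = ladder (m + 1) d
            \<union> (if m > 0 then ladder (m - 1) d else if d > 0 then ladder 1 (d - 1) else {})" .
        \<comment> \<open>The two shifted copies differ by a shift of 2, the gap of a ladder, so
          they merge into a single ladder.\<close>
        moreover have "ladder (m + 1) d \<union> ladder (m - 1) d = ladder (m - 1) (d + 1)" if "m > 0"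
          using that by (intro set_eqI) (simp add: mem_ladder_iff of_nat_diff, presburger)
        moreover have "ladder 1 d \<union> ladder 1 (d - 1) = ladder 1 d" if "d > 0"
          using that by (intro set_eqI) (simp add: mem_ladder_iff of_nat_diff, presburger)
        ultimately show ?thesis by (cases "m > 0"; cases "d > 0") auto
      qed
      then show ?thesis using 3 pm by (auto simp: st step_def returns_snoc IH ladder_eq_0_iff)
    qed
  qed
qed

lemma N_excursion_iff: "N_excursion s \<longleftrightarrow> 0 \<in> reachable s"
  unfolding N_excursion_def reachable_def excursion_def mem_Collect_eq by metis

lemma N_meander_iff: "N_meander s \<longleftrightarrow> reachable s \<noteq> {}"
  unfolding N_meander_def reachable_def by blast

lemma finite_dyck_N_walks [simp]: "finite (dyck_N_walks n)"
  unfolding dyck_N_walks_def by (rule finite_lists_length_eq) auto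

lemma sum_dyck_N_walks_0: "(\<Sum>s\<in>dyck_N_walks 0. f s) = f []"
proof -
  have "dyck_N_walks 0 = {[]}" by (auto simp: dyck_N_walks_def)
  then show ?thesis by simp
qed

lemma sum_dyck_N_walks_Suc:
  "(\<Sum>s\<in>dyck_N_walks (Suc n). f s)
   = (\<Sum>s\<in>dyck_N_walks n. f (s @ [{-1}]) + f (s @ [{1}]) + f (s @ [{-1, 1}]))"
proof -
  let ?S = "{{-1}, {1}, {-1, 1 :: int}}"
  have eq: "dyck_N_walks (Suc n) = (\<lambda>(s, x). s @ [x]) ` (dyck_N_walks n \<times> ?S)"
  proof (intro equalityI subsetI)
    fix s assume "s \<in> dyck_N_walks (Suc n)"
    then show "s \<in> (\<lambda>(s, x). s @ [x]) ` (dyck_N_walks n \<times> ?S)"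
      by (cases s rule: rev_cases) (auto simp: dyck_N_walks_def image_iff)
  qed (auto simp: dyck_N_walks_def)
  have ne: "({-1} :: int set) \<noteq> {1}" "({-1} :: int set) \<noteq> {-1, 1}" "({1} :: int set) \<noteq> {-1, 1}"
    by auto
  have "(\<Sum>s\<in>dyck_N_walks (Suc n). f s) = (\<Sum>(s, x)\<in>dyck_N_walks n \<times> ?S. f (s @ [x]))"
    unfolding eq by (subst sum.reindex) (auto simp: inj_on_def case_prod_unfold)
  also have "\<dots> = (\<Sum>s\<in>dyck_N_walks n. \<Sum>x\<in>?S. f (s @ [x]))"
    by (rule sum.cartesian_product[symmetric])
  also have "\<dots> = (\<Sum>s\<in>dyck_N_walks n. f (s @ [{-1}]) + f (s @ [{1}]) + f (s @ [{-1, 1}]))"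
    using ne by (intro sum.cong refl) (simp add: add.assoc)
  finally show ?thesis .
qed

section \<open>Weighted sums over walks and their one-step recursions\<close>

definition walk_sum ::
    "(int set \<Rightarrow> real) \<Rightarrow> ((nat \<times> nat \<times> nat) option \<Rightarrow> real) \<Rightarrow> real fps" where
  "walk_sum p f = Abs_fps (\<lambda>n. \<Sum>s\<in>dyck_N_walks n. weight p s * f (state s))"

text \<open>Split off the last step: \<open>g\<close> is the transfer operator of the automaton
  applied to \<open>f\<close>, and the constant term comes from the empty walk.\<close>

lemma walk_sum_eq:
  assumes "\<And>\<sigma>. p {-1} * f (step \<sigma> {-1}) + p {1} * f (step \<sigma> {1})
                + p {-1, 1} * f (step \<sigma> {-1, 1}) = g \<sigma>"
  shows "walk_sum p f = fps_const (f (Some (0, 0, 0))) + fps_X * walk_sum p g"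
proof (rule fps_ext)
  fix n
  show "fps_nth (walk_sum p f) n = fps_nth (fps_const (f (Some (0, 0, 0))) + fps_X * walk_sum p g) n"
  proof (cases n)
    case 0
    then show ?thesis by (simp add: walk_sum_def sum_dyck_N_walks_0 weight_def)
  next
    case (Suc k)
    show ?thesis
      unfolding Suc walk_sum_def
      by (simp add: sum_dyck_N_walks_Suc weight_def assms[symmetric] algebra_simps)
  qed
qed

lemma walk_sum_add: "walk_sum p (\<lambda>\<sigma>. f \<sigma> + g \<sigma>) = walk_sum p f + walk_sum p g"
  by (rule fps_ext) (simp add: walk_sum_def sum.distrib algebra_simps)

lemma walk_sum_cmult: "walk_sum p (\<lambda>\<sigma>. c * f \<sigma>) = fps_const c * walk_sum p f"
  by (rule fps_ext) (simp add: walk_sum_def sum_distrib_left algebra_simps)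

text \<open>The weight \<open>\<phi>\<close> of the number of returns stays arbitrary because a
  return turns it into its shift. The constant 1 then gives all walks, and an indicator those with
  exactly k returns.\<close>

definition max_at :: "(nat \<Rightarrow> real) \<Rightarrow> nat \<Rightarrow> (nat \<times> nat \<times> nat) option \<Rightarrow> real" where
  "max_at \<phi> M \<sigma> = (case \<sigma> of None \<Rightarrow> 0 | Some (m, d, r) \<Rightarrow> if m + 2 * d = M then \<phi> r else 0)"

definition min_at :: "(nat \<Rightarrow> real) \<Rightarrow> nat \<Rightarrow> (nat \<times> nat \<times> nat) option \<Rightarrow> real" where
  "min_at \<phi> l \<sigma> = (case \<sigma> of None \<Rightarrow> 0 | Some (m, d, r) \<Rightarrow> if m = l then \<phi> r else 0)"

lemma max_at_start [simp]: "max_at \<phi> M (Some (0, 0, 0)) = (if M = 0 then \<phi> 0 else 0)"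
  and min_at_start [simp]: "min_at \<phi> l (Some (0, 0, 0)) = (if l = 0 then \<phi> 0 else 0)"
  by (auto simp: max_at_def min_at_def)

context
  fixes p :: "int set \<Rightarrow> real"
  assumes sum_one: "p {-1} + p {1} + p {-1, 1} = 1"
begin

private lemma both: "p {-1, 1} = 1 - p {-1} - p {1}"
  using sum_one by simp

private lemma steps_ne: "{-1, 1 :: int} \<noteq> {1}" "{-1, 1 :: int} \<noteq> {-1}" "{-1 :: int} \<noteq> {1}"
    "{1 :: int} \<noteq> {-1}"
  by auto

text \<open>Maximum 0 is entered only by \<open>{-1}\<close> from maximum 1. There the reachable set
  is the single point 1, so each such entry is a return.\<close>

lemma walk_sum_max_0:
  "walk_sum p (max_at \<phi> 0) = fps_const (\<phi> 0)
     + fps_const (p {-1}) * fps_X * walk_sum p (max_at (\<lambda>r. \<phi> (Suc r)) 1)"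
proof -
  have "walk_sum p (max_at \<phi> 0) = fps_const (max_at \<phi> 0 (Some (0, 0, 0)))
      + fps_X * walk_sum p (\<lambda>\<sigma>. p {-1} * max_at (\<lambda>r. \<phi> (Suc r)) 1 \<sigma>)"
    by (rule walk_sum_eq) (auto simp: max_at_def step_def steps_ne both split: option.split if_splits)
  then show ?thesis
    unfolding walk_sum_add walk_sum_cmult by (simp add: algebra_simps)
qed

lemma walk_sum_max_Suc:
  "walk_sum p (max_at \<phi> (Suc M)) = fps_const (1 - p {-1}) * fps_X * walk_sum p (max_at \<phi> M)
     + fps_const (p {-1}) * fps_X * walk_sum p (max_at \<phi> (M + 2))"
proof -
  have "walk_sum p (max_at \<phi> (Suc M)) = fps_const (max_at \<phi> (Suc M) (Some (0, 0, 0)))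
      + fps_X * walk_sum p (\<lambda>\<sigma>. (1 - p {-1}) * max_at \<phi> M \<sigma> + p {-1} * max_at \<phi> (M + 2) \<sigma>)"
    apply (rule walk_sum_eq)
    subgoal for \<sigma>
      by (cases \<sigma>) (auto simp: max_at_def step_def steps_ne both algebra_simps split: if_splits)
    done
  then show ?thesis
    unfolding walk_sum_add walk_sum_cmult by (simp add: algebra_simps)
qed

text \<open>The minimum passes from 1 to 0 with weight 1 - b. If the maximum is also 1, the step
  \<open>{-1}\<close> adds a return; the last two terms replace the unshifted weight by the shifted
  one.\<close>

lemma walk_sum_min_0:
  "walk_sum p (min_at \<phi> 0) = fps_const (\<phi> 0)
     + fps_const (1 - p {1}) * fps_X * walk_sum p (min_at \<phi> 1)
     - fps_const (p {-1}) * fps_X * walk_sum p (max_at \<phi> 1)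
     + fps_const (p {-1}) * fps_X * walk_sum p (max_at (\<lambda>r. \<phi> (Suc r)) 1)"
proof -
  have "walk_sum p (min_at \<phi> 0) = fps_const (min_at \<phi> 0 (Some (0, 0, 0)))
      + fps_X * walk_sum p (\<lambda>\<sigma>. (1 - p {1}) * min_at \<phi> 1 \<sigma> + ((- p {-1}) * max_at \<phi> 1 \<sigma>
          + p {-1} * max_at (\<lambda>r. \<phi> (Suc r)) 1 \<sigma>))"
    apply (rule walk_sum_eq)
    subgoal for \<sigma>
      by (cases \<sigma>)
        (auto simp: max_at_def min_at_def step_def steps_ne both algebra_simps split: if_splits)
    done
  then show ?thesis
    unfolding walk_sum_add walk_sum_cmult by (simp add: algebra_simps flip: fps_const_neg)
qed

text \<open>From minimum 0 every step leads to minimum 1, by parity and the loss of the point 0. The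
  exception is \<open>{-1}\<close> at maximum 0, where the walk dies; this is the subtracted
  term.\<close>

lemma walk_sum_min_1:
  "walk_sum p (min_at \<phi> 1) = fps_X * walk_sum p (min_at \<phi> 0)
     - fps_const (p {-1}) * fps_X * walk_sum p (max_at \<phi> 0)
     + fps_const (1 - p {1}) * fps_X * walk_sum p (min_at \<phi> 2)"
proof -
  have "walk_sum p (min_at \<phi> 1) = fps_const (min_at \<phi> 1 (Some (0, 0, 0)))
      + fps_X * walk_sum p (\<lambda>\<sigma>. min_at \<phi> 0 \<sigma> + ((- p {-1}) * max_at \<phi> 0 \<sigma>
          + (1 - p {1}) * min_at \<phi> 2 \<sigma>))"
    apply (rule walk_sum_eq)
    subgoal for \<sigma>
      by (cases \<sigma>)
        (auto simp: max_at_def min_at_def step_def steps_ne both algebra_simps split: if_splits)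
    done
  then show ?thesis
    unfolding walk_sum_add walk_sum_cmult by (simp add: algebra_simps flip: fps_const_neg)
qed

lemma walk_sum_min_Suc_Suc:
  "walk_sum p (min_at \<phi> (m + 2)) = fps_const (p {1}) * fps_X * walk_sum p (min_at \<phi> (m + 1))
     + fps_const (1 - p {1}) * fps_X * walk_sum p (min_at \<phi> (m + 3))"
proof -
  have "walk_sum p (min_at \<phi> (m + 2)) = fps_const (min_at \<phi> (m + 2) (Some (0, 0, 0)))
      + fps_X * walk_sum p (\<lambda>\<sigma>. p {1} * min_at \<phi> (m + 1) \<sigma> + (1 - p {1}) * min_at \<phi> (m + 3) \<sigma>)"
    apply (rule walk_sum_eq)
    subgoal for \<sigma>
      by (cases \<sigma>) (auto simp: min_at_def step_def steps_ne both algebra_simps split: if_splits)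
    done
  then show ?thesis
    unfolding walk_sum_add walk_sum_cmult by (simp add: algebra_simps)
qed

end

section \<open>Generating functions\<close>

text \<open>The generating functions by maximum and by minimum of the reachable set are guessed and
  then verified against the one-step recursions, which determine them.  Here \<open>W\<close> counts first
  returns to the reachable set \<open>{0}\<close>, so \<open>Abs_fps \<phi> oo W\<close> is the contribution of the part of a
  walk up to its last return, and \<open>1 - W\<close> removes the returns from what follows.\<close>

context
  fixes p :: "int set \<Rightarrow> real" and W P q G\<^sub>0 G\<^sub>1 r :: "real fps"
  assumes sum_one: "p {-1} + p {1} + p {-1, 1} = 1"
    and W0: "fps_nth W 0 = 0"
    and q_eq: "q = fps_const (1 - p {-1}) * fps_X + fps_const (p {-1}) * fps_X * q ^ 2"
    and Wq: "W = fps_const (p {-1}) * fps_X * q"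
    and WP: "(1 - W) * P = 1"
    and G0_eq: "G\<^sub>0 = 1 + fps_const (1 - p {1}) * fps_X * G\<^sub>1"
    and G1_eq: "G\<^sub>1 = fps_X * (G\<^sub>0 - fps_const (p {-1}) * P)
                  + fps_const (1 - p {1}) * fps_X * (G\<^sub>1 * r)"
    and r_eq: "r = fps_const (p {1}) * fps_X + fps_const (1 - p {1}) * fps_X * r ^ 2"
begin

private abbreviation returns_gf :: "(nat \<Rightarrow> real) \<Rightarrow> real fps" where
  "returns_gf \<phi> \<equiv> Abs_fps \<phi> oo W"

lemma returns_gf_rec:
  "returns_gf \<phi> = fps_const (\<phi> 0) + W * returns_gf (\<lambda>k. \<phi> (Suc k))"
proof -
  have "Abs_fps \<phi> = fps_const (\<phi> 0) + fps_X * Abs_fps (\<lambda>k. \<phi> (Suc k))"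
    by (rule fps_ext) (simp add: gr0_conv_Suc split: nat.split)
  then show ?thesis
    using W0 by (metis fps_compose_add_distrib fps_compose_mult_distrib fps_const_compose fps_X_fps_compose_startby0)
qed

text \<open>Beyond constants, each recursion has a factor \<open>fps_X\<close> on the right, so
  induction on the coefficient index works for all weights and levels at once. Each power of
  \<open>q\<close> accounts for one level left upwards for the last time.\<close>

lemma walk_sum_max: "walk_sum p (max_at \<phi> M) = returns_gf \<phi> * q ^ M"
proof (rule fps_ext)
  fix n
  show "fps_nth (walk_sum p (max_at \<phi> M)) n = fps_nth (returns_gf \<phi> * q ^ M) n"
  proof (induction n arbitrary: \<phi> M)
    have cand0: "returns_gf \<phi> * q ^ 0 = fps_const (\<phi> 0)
        + fps_const (p {-1}) * fps_X * (returns_gf (\<lambda>k. \<phi> (Suc k)) * q ^ 1)" for \<phi>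
      by (subst returns_gf_rec) (simp add: Wq algebra_simps)
    have candSuc: "returns_gf \<phi> * q ^ Suc M
        = fps_const (1 - p {-1}) * fps_X * (returns_gf \<phi> * q ^ M)
          + fps_const (p {-1}) * fps_X * (returns_gf \<phi> * q ^ (M + 2))" for \<phi> M
    proof -
      have "x * (y * z) = u * X * (x * y) + v * X * (x * (y * z ^ 2))"
        if z: "z = u * X + v * X * z ^ 2" for x y z u v X :: "real fps"
      proof -
        have "x * (y * z) = x * (y * (u * X + v * X * z ^ 2))"
          by (rule arg_cong[OF z])
        also have "\<dots> = u * X * (x * y) + v * X * (x * (y * z ^ 2))"
          by (simp only: distrib_left mult_ac)
        finally show ?thesis .
      qed
      from this[OF q_eq] show ?thesis
        by (simp only: power_add power_Suc2)
    qed
    case 0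
    show ?case
    proof (cases M)
      case 0
      then show ?thesis
        by (simp only: walk_sum_max_0[OF sum_one] cand0) (simp add: mult.assoc)
    next
      case (Suc M')
      then show ?thesis
        by (simp only: walk_sum_max_Suc[OF sum_one] candSuc) (simp add: mult.assoc)
    qed
    case (Suc n)
    show ?case
    proof (cases M)
      case 0
      then show ?thesis
        by (simp only: walk_sum_max_0[OF sum_one] cand0) (simp add: mult.assoc Suc.IH)
    next
      case (Suc M')
      then show ?thesis
        by (simp only: walk_sum_max_Suc[OF sum_one] candSuc) (simp add: mult.assoc Suc.IH)
    qed
  qed
qed


lemma walk_sum_min: "walk_sum p (min_at \<phi> 0) = returns_gf \<phi> * (1 - W) * G\<^sub>0"
proof -
  \<comment> \<open>Candidates for all levels of the minimum: above level 1 the recursion is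
    homogeneous, hence geometric in \<open>r\<close>; level 0 is separate because of the reflection
    there.\<close>
  define D where "D = (\<lambda>\<phi> m. returns_gf \<phi> * (1 - W) * (case m of 0 \<Rightarrow> G\<^sub>0 | Suc m \<Rightarrow> G\<^sub>1 * r ^ m))"
  have D0: "D \<phi> 0 = fps_const (\<phi> 0) + fps_const (1 - p {1}) * fps_X * D \<phi> 1
      - fps_const (p {-1}) * fps_X * (returns_gf \<phi> * q ^ 1)
      + fps_const (p {-1}) * fps_X * (returns_gf (\<lambda>k. \<phi> (Suc k)) * q ^ 1)" for \<phi>
  proof -
    have "x * (1 - w) * g = c + u * X * (x * (1 - w) * h) - v * X * (x * y) + v * X * (x' * y)"
      if "x = c + w * x'" "w = v * X * y" "g = 1 + u * X * h" for x x' w g h c u v X y :: "real fps"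
    proof -
      have "x * (1 - w) * g = (x - x * w) + x * (1 - w) * (u * X * h)"
        using that(3) by (simp add: algebra_simps)
      also have "x - x * w = (c + w * x') - x * w" using that(1) by simp
      also have "\<dots> = c + v * X * (x' * y) - v * X * (x * y)"
        using that(2) by (simp add: algebra_simps)
      finally show ?thesis by (simp add: algebra_simps)
    qed
    from this[OF returns_gf_rec Wq G0_eq] show ?thesis by (simp add: D_def)
  qed
  have D1: "D \<phi> 1 = fps_X * D \<phi> 0 - fps_const (p {-1}) * fps_X * (returns_gf \<phi> * q ^ 0)
     + fps_const (1 - p {1}) * fps_X * D \<phi> 2" for \<phi>
  proof -
    have "x * (1 - w) * h = X * (x * (1 - w) * g) - v * X * x + u * X * (x * (1 - w) * (h * r))"
      if wy: "(1 - w) * y = 1" and h: "h = X * (g - v * y) + u * X * (h * r)"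
      for x w g h u v X y r :: "real fps"
    proof -
      have "x * (1 - w) * h = x * (1 - w) * (X * (g - v * y) + u * X * (h * r))"
        by (rule arg_cong[OF h])
      also have "\<dots> = X * (x * (1 - w) * g) - v * X * x * ((1 - w) * y)
          + u * X * (x * (1 - w) * (h * r))"
        by (simp add: algebra_simps)
      finally show ?thesis by (simp add: wy)
    qed
    from this[OF WP G1_eq] show ?thesis by (simp add: D_def numeral_2_eq_2)
  qed
  have D2: "D \<phi> (m + 2) = fps_const (p {1}) * fps_X * D \<phi> (m + 1)
     + fps_const (1 - p {1}) * fps_X * D \<phi> (m + 3)" for \<phi> m
  proof -
    have "x * (g * (y * z)) = u * X * (x * (g * y)) + v * X * (x * (g * (y * z ^ 2)))"
      if z: "z = u * X + v * X * z ^ 2" for x y z u v X g :: "real fps"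
    proof -
      have "x * (g * (y * z)) = x * (g * (y * (u * X + v * X * z ^ 2)))"
        by (rule arg_cong[OF z])
      also have "\<dots> = u * X * (x * (g * y)) + v * X * (x * (g * (y * z ^ 2)))"
        by (simp only: distrib_left mult_ac)
      finally show ?thesis .
    qed
    note eq = this[OF r_eq]
    have D_Suc: "D \<phi> (Suc k) = returns_gf \<phi> * (1 - W) * (G\<^sub>1 * r ^ k)" for k
      by (simp add: D_def)
    have "m + 2 = Suc (Suc m)" "m + 1 = Suc m" "m + 3 = Suc (Suc (Suc m))" by simp_all
    moreover have "r ^ Suc m = r ^ m * r" "r ^ Suc (Suc m) = r ^ m * r ^ 2"
      by (simp_all add: power2_eq_square mult_ac)
    ultimately show ?thesis by (simp only: D_Suc eq)
  qed
  have "fps_nth (walk_sum p (min_at \<phi> m)) n = fps_nth (D \<phi> m) n" for \<phi> m n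
  proof (induction n arbitrary: \<phi> m)
    case 0
    consider "m = 0" | "m = 1" | m' where "m = m' + 2"
      by (metis One_nat_def Suc_1 add_2_eq_Suc' not0_implies_Suc)
    then show ?case
    proof cases
      case 1
      then show ?thesis
        by (simp only: walk_sum_min_0[OF sum_one] D0) (simp add: mult.assoc)
    next
      case 2
      then show ?thesis
        by (simp only: walk_sum_min_1[OF sum_one] D1) (simp add: mult.assoc)
    next
      case 3
      then show ?thesis
        by (simp only: walk_sum_min_Suc_Suc[OF sum_one] D2) (simp add: mult.assoc)
    qed
  next
    case (Suc n)
    consider "m = 0" | "m = 1" | m' where "m = m' + 2"
      by (metis One_nat_def Suc_1 add_2_eq_Suc' not0_implies_Suc)
    then show ?case
    proof cases
      case 1
      then show ?thesis
        by (simp only: walk_sum_min_0[OF sum_one] walk_sum_max D0) (simp add: mult.assoc Suc.IH)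
    next
      case 2
      then show ?thesis
        by (simp only: walk_sum_min_1[OF sum_one] walk_sum_max D1) (simp add: mult.assoc Suc.IH)
    next
      case 3
      then show ?thesis
        by (simp only: walk_sum_min_Suc_Suc[OF sum_one] D2) (simp add: mult.assoc Suc.IH)
    qed
  qed
  then have "walk_sum p (min_at \<phi> m) = D \<phi> m" for m
    by (simp add: fps_eq_iff)
  from this[of 0] show ?thesis by (simp add: D_def)
qed

lemma returns_gf_1: "returns_gf (\<lambda>_. 1) = P"
proof -
  have "returns_gf (\<lambda>_. 1) * (1 - W) = 1"
    using returns_gf_rec[of "\<lambda>_. 1"] by (simp add: algebra_simps)
  then show ?thesis using WP by algebra
qed

lemma returns_gf_delta: "returns_gf (\<lambda>r. if r = k then 1 else 0) = W ^ k"
proof -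
  have "Abs_fps (\<lambda>r. if r = k then 1 else 0) = (fps_X ^ k :: real fps)"
    by (rule fps_ext) simp
  then show ?thesis
    using fps_compose_power[OF W0, of fps_X k] W0 by (simp add: fps_X_fps_compose_startby0)
qed

lemma D00_eq: "D00 p = P"
proof -
  have "D00 p = walk_sum p (max_at (\<lambda>_. 1) 0)"
  proof (rule fps_ext)
    fix n
    have "(if N_meander s \<and> reachable s = {0} then weight p s else 0)
        = weight p s * max_at (\<lambda>_. 1) 0 (state s)" if "s \<in> dyck_N_walks n" for s
    proof (cases "state s")
      case None
      then have "reachable s = {}"
        using state_correct[of s] that by (simp add: dyck_N_walks_def)
      then show ?thesis using None by (simp add: max_at_def)
    next
      case (Some \<tau>)
      obtain m d r where \<tau>: "\<tau> = (m, d, r)" by (cases \<tau>)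
      then have "reachable s = ladder m d"
        using state_correct[of s] that Some by (simp add: dyck_N_walks_def)
      then have "N_meander s \<and> reachable s = {0} \<longleftrightarrow> m + 2 * d = 0"
        using ladder_eq_0_iff[of m d] by (auto simp: N_meander_iff)
      then show ?thesis using Some \<tau> by (simp add: max_at_def)
    qed
    then show "fps_nth (D00 p) n = fps_nth (walk_sum p (max_at (\<lambda>_. 1) 0)) n"
      by (simp add: D00_def walk_sum_def sum.inter_filter)
  qed
  then show ?thesis by (simp add: walk_sum_max returns_gf_1)
qed

lemma D01_eq: "D01 p = G\<^sub>0"
proof -
  have "D01 p = walk_sum p (min_at (\<lambda>_. 1) 0)"
  proof (rule fps_ext)
    fix n
    have "(if N_excursion s then weight p s else 0)
        = weight p s * min_at (\<lambda>_. 1) 0 (state s)" if "s \<in> dyck_N_walks n" for s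
      using state_correct[of s] that
      by (auto simp: dyck_N_walks_def min_at_def N_excursion_iff zero_in_ladder_iff split: option.splits)
    then show "fps_nth (D01 p) n = fps_nth (walk_sum p (min_at (\<lambda>_. 1) 0)) n"
      by (simp add: D01_def walk_sum_def sum.inter_filter)
  qed
  then show ?thesis using WP by (simp add: walk_sum_min returns_gf_1 mult.commute[of P])
qed

text \<open>This gives the coefficients of F their meaning as counts of excursions by returns: k
  first-return blocks, then an excursion without further return.\<close>

lemma excursions_by_returns:
  "(\<Sum>s\<in>{s \<in> dyck_N_walks n. N_excursion s \<and> returns s = k}. weight p s)
   = fps_nth (W ^ k * (1 - W) * G\<^sub>0) n"
proof -
  have "(if N_excursion s \<and> returns s = k then weight p s else 0)
      = weight p s * min_at (\<lambda>r. if r = k then 1 else 0) 0 (state s)" if "s \<in> dyck_N_walks n" for s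
    using state_correct[of s] that
    by (auto simp: dyck_N_walks_def min_at_def N_excursion_iff zero_in_ladder_iff split: option.splits)
  then have "(\<Sum>s\<in>{s \<in> dyck_N_walks n. N_excursion s \<and> returns s = k}. weight p s)
      = fps_nth (walk_sum p (min_at (\<lambda>r. if r = k then 1 else 0) 0)) n"
    by (simp add: walk_sum_def sum.inter_filter)
  then show ?thesis by (simp add: walk_sum_min returns_gf_delta)
qed

lemma F_gf_nth: "fps_nth (F_gf p) k = W ^ k * (1 - W) * G\<^sub>0"
proof -
  define c where "c = 1 - 1 / D00 p"
  have P0: "fps_nth P 0 \<noteq> 0"
    using WP W0 by (metis fps_mult_nth_0 fps_one_nth mult_zero_right zero_neq_one)
  have inv: "inverse P = 1 - W"
    by (rule fps_inverse_unique) (use WP in \<open>simp add: mult.commute\<close>)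
  then have c: "c = W" unfolding c_def D00_eq using P0 by (simp add: fps_divide_unit)
  have one: "inverse (1 :: real fps) = 1" by simp
  have geom: "Abs_fps (\<lambda>k. c ^ k) = inverse (1 - fps_X * fps_const c)"
  proof -
    have "(1 - fps_X * fps_const c) * Abs_fps (\<lambda>k. c ^ k) = 1"
    proof (rule fps_ext)
      fix n
      show "fps_nth ((1 - fps_X * fps_const c) * Abs_fps (\<lambda>k. c ^ k)) n = fps_nth 1 n"
        by (cases n) (simp_all add: left_diff_distrib mult.assoc)
    qed
    \<comment> \<open>The coefficients lie in \<open>real fps\<close>, which is not a field, so the
      inverse is identified by uniqueness of inverses in a ring.\<close>
    then have "fps_right_inverse (1 - fps_X * fps_const c) (fps_nth (Abs_fps (\<lambda>k. c ^ k)) 0)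
        = Abs_fps (\<lambda>k. c ^ k)"
      by (intro fps_lr_inverse_unique_ring1(2)) simp_all
    moreover have "fps_nth (1 - fps_X * fps_const c) 0 = 1" by simp
    moreover have "fps_nth (Abs_fps (\<lambda>k. c ^ k)) 0 = 1" by simp
    ultimately show ?thesis by (simp only: fps_inverse_def[of "1 - fps_X * fps_const c"] one)
  qed
  have "subdegree (1 - fps_X * fps_const c) = 0" by (simp add: subdegree_eq_0_iff)
  then have "F_gf p = Abs_fps (\<lambda>k. c ^ k) * fps_const (D01 p / D00 p)"
    unfolding F_gf_def c_def[symmetric] geom by (simp add: fps_divide_unit')
  then show ?thesis
    using P0 by (simp add: c D00_eq D01_eq fps_divide_unit inv mult_ac)
qed

end

section \<open>Sequences comparable to the Catalan numbers\<close>

text \<open>The Catalan numbers divided by 4^n, which moves the singularity of their series to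
  1.\<close>

primrec catal :: "nat \<Rightarrow> real" where
  "catal 0 = 1"
| "catal (Suc n) = catal n * (2 * real n + 1) / (2 * real n + 4)"

lemma catal_pos [simp]: "0 < catal n"
  by (induction n) auto

lemma catal_neq_0 [simp]: "catal n \<noteq> 0" and abs_catal [simp]: "\<bar>catal n\<bar> = catal n"
  using catal_pos[of n] by linarith+

text \<open>A squared form of the order n^(-3/2). The induction step is the inequality of means for
  n + 1/2, n + 1/2 and n + 2, whose mean is n + 1.\<close>

lemma catal_upper: "catal n ^ 2 * (real n + 1) ^ 3 \<le> 1"
proof (induction n)
  case (Suc n)
  have "(2 * real n + 1) ^ 2 * (real n + 2) \<le> 4 * (real n + 1) ^ 3"
    by (simp add: power2_eq_square power3_eq_cube algebra_simps)
  then have "(2 * real n + 1) ^ 2 * (real n + 2) ^ 3 \<le> (2 * real n + 4) ^ 2 * (real n + 1) ^ 3"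
    using mult_right_mono[of "(2 * real n + 1) ^ 2 * (real n + 2)" "4 * (real n + 1) ^ 3" "(real n + 2) ^ 2"]
    by (simp add: power2_eq_square power3_eq_cube algebra_simps)
  then have "((2 * real n + 1) / (2 * real n + 4)) ^ 2 * (real n + 2) ^ 3 \<le> (real n + 1) ^ 3"
    by (simp add: power_divide divide_le_eq mult.commute)
  then have "catal n ^ 2 * (((2 * real n + 1) / (2 * real n + 4)) ^ 2 * (real n + 2) ^ 3)
      \<le> catal n ^ 2 * (real n + 1) ^ 3"
    by (intro mult_left_mono) auto
  with Suc have "catal n ^ 2 * (((2 * real n + 1) / (2 * real n + 4)) ^ 2 * (real n + 2) ^ 3) \<le> 1"
    by linarith
  also have "catal n ^ 2 * (((2 * real n + 1) / (2 * real n + 4)) ^ 2 * (real n + 2) ^ 3)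
      = catal (Suc n) ^ 2 * (real (Suc n) + 1) ^ 3"
    by (simp add: power_mult_distrib power_divide add.commute)
  finally show ?case .
qed simp

text \<open>Again the inequality of means, now for 2n + 4, 2n + 4 and 2n + 1 with mean 2n +
  3.\<close>

lemma catal_lower: "1 \<le> catal n ^ 2 * (2 * real n + 1) ^ 3"
proof (induction n)
  case (Suc n)
  have "(2 * real n + 4) ^ 2 * (2 * real n + 1) \<le> (2 * real n + 3) ^ 3"
    by (simp add: power2_eq_square power3_eq_cube algebra_simps)
  then have "(2 * real n + 4) ^ 2 * (2 * real n + 1) ^ 3 \<le> (2 * real n + 1) ^ 2 * (2 * real n + 3) ^ 3"
    using mult_right_mono[of "(2 * real n + 4) ^ 2 * (2 * real n + 1)" "(2 * real n + 3) ^ 3" "(2 * real n + 1) ^ 2"]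
    by (simp add: power2_eq_square power3_eq_cube algebra_simps)
  then have "(2 * real n + 1) ^ 3 \<le> ((2 * real n + 1) / (2 * real n + 4)) ^ 2 * (2 * real n + 3) ^ 3"
    by (simp add: power_divide le_divide_eq mult.commute)
  then have "catal n ^ 2 * (2 * real n + 1) ^ 3
      \<le> catal n ^ 2 * (((2 * real n + 1) / (2 * real n + 4)) ^ 2 * (2 * real n + 3) ^ 3)"
    by (intro mult_left_mono) auto
  with Suc have "1 \<le> catal n ^ 2 * (((2 * real n + 1) / (2 * real n + 4)) ^ 2 * (2 * real n + 3) ^ 3)"
    by linarith
  also have "\<dots> = catal (Suc n) ^ 2 * (2 * real (Suc n) + 1) ^ 3"
    by (simp add: power_mult_distrib power_divide add.commute)
  finally show ?case .
qed simp

text \<open>From 2n + 1 <= 4 (m + 1) the cubes in the two bounds differ by at most the factor 64 =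
  8^2.\<close>

lemma catal_half:
  assumes "n \<le> 2 * m"
  shows "catal m \<le> 8 * catal n"
proof -
  have "catal m ^ 2 * (real m + 1) ^ 3 \<le> catal n ^ 2 * (2 * real n + 1) ^ 3"
    using catal_upper[of m] catal_lower[of n] by linarith
  also have "\<dots> \<le> catal n ^ 2 * (4 * (real m + 1)) ^ 3"
    using assms by (intro mult_left_mono power_mono) auto
  also have "\<dots> = (8 * catal n) ^ 2 * (real m + 1) ^ 3"
    by (simp only: power_mult_distrib) simp
  finally have "catal m ^ 2 \<le> (8 * catal n) ^ 2"
    by (rule mult_right_le_imp_le) simp
  then show ?thesis
    by (rule power2_le_imp_le) (simp add: less_imp_le)
qed

lemma summable_catal: "summable catal"
proof (rule summable_comparison_test')
  show "summable (\<lambda>n. (real n + 1) powr (- 3/2))"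
    using summable_real_powr_iff[of "-3/2"] summable_Suc_iff[of "\<lambda>n. real n powr (-3/2)"]
    by (simp add: add.commute)
  fix n :: nat
  have "catal n ^ 2 \<le> ((real n + 1) powr (- 3/2)) ^ 2"
  proof -
    have "((real n + 1) powr (- 3/2)) ^ 2 = (real n + 1) powr (- 3)"
      by (simp add: power2_eq_square flip: powr_add)
    also have "\<dots> = 1 / (real n + 1) ^ 3"
      using powr_realpow[of "real n + 1" 3] by (simp add: powr_minus_divide)
    finally show ?thesis
      using catal_upper[of n] by (simp add: le_divide_eq)
  qed
  then have "catal n \<le> (real n + 1) powr (- 3/2)"
    by (rule power2_le_imp_le) simp
  then show "norm (catal n) \<le> (real n + 1) powr (- 3/2)"
    by (simp add: less_imp_le)
qed

lemma catal_shift_ratio: "(\<lambda>n. catal (n - i) / catal n) \<longlonglongrightarrow> 1"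
proof -
  \<comment> \<open>Shifting upwards first avoids truncated subtraction; the ratio of neighbours
    tends to 1.\<close>
  have "(\<lambda>n. catal n / catal (n + i)) \<longlonglongrightarrow> 1"
  proof (induction i)
    case 0
    show ?case by simp
  next
    case (Suc i)
    have "(\<lambda>n. (2 * real (n + i) + 4) / (2 * real (n + i) + 1)) \<longlonglongrightarrow> 1"
      by real_asymp
    from tendsto_mult[OF Suc this]
    have "(\<lambda>n. catal n / catal (n + i) * ((2 * real (n + i) + 4) / (2 * real (n + i) + 1))) \<longlonglongrightarrow> 1"
      by simp
    moreover have "catal n / catal (n + i) * ((2 * real (n + i) + 4) / (2 * real (n + i) + 1))
        = catal n / catal (n + Suc i)" for n
      by simp
    ultimately show ?case by simp
  qed
  then show ?thesis
    by (intro LIMSEQ_offset[of "\<lambda>n. catal (n - i) / catal n" i]) simp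
qed


text \<open>The half sum keeps the index \<open>n - i\<close> of \<open>G\<close> at least \<open>n / 2\<close>, where
  \<open>catal (n - i) \<le> 8 * catal n\<close> provides the domination needed for Tannery's theorem.\<close>

lemma half_convolution_limit:
  fixes F G :: "nat \<Rightarrow> real"
  assumes F: "summable (\<lambda>n. \<bar>F n\<bar>)"
    and G: "(\<lambda>n. G n / catal n) \<longlonglongrightarrow> m"
    and R: "\<And>i n. R i n \<Longrightarrow> 2 * i \<le> n" "\<And>i. eventually (R i) sequentially"
  shows "(\<lambda>n. (\<Sum>i | i \<le> n \<and> R i n. F i * G (n - i)) / catal n) \<longlonglongrightarrow> m * suminf F"
proof -
  obtain C where C: "\<And>n. \<bar>G n / catal n\<bar> \<le> C"
    using convergent_imp_Bseq[OF convergentI[OF G]] by (auto simp: Bseq_def)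
  have GC: "\<bar>G n\<bar> \<le> C * catal n" for n
    using C[of n] by (simp add: divide_le_eq)
  have C0: "0 \<le> C" using C[of 0] by linarith
  define u where "u = (\<lambda>i n. if R i n then F i * G (n - i) / catal n else 0)"
  have "(\<lambda>n. u i n) \<longlonglongrightarrow> F i * m" for i
  proof -
    have "(\<lambda>n. G (n - i) / catal (n - i)) \<longlonglongrightarrow> m"
      by (rule LIMSEQ_offset[of _ i]) (use G in simp)
    from tendsto_mult[OF this catal_shift_ratio[of i]]
    have "(\<lambda>n. G (n - i) / catal n) \<longlonglongrightarrow> m" by simp
    then have "(\<lambda>n. F i * (G (n - i) / catal n)) \<longlonglongrightarrow> F i * m" by (rule tendsto_mult_left)
    moreover have "\<forall>\<^sub>F n in sequentially. F i * (G (n - i) / catal n) = u i n"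
      using R(2)[of i] by eventually_elim (simp add: u_def)
    ultimately show ?thesis by (rule Lim_transform_eventually)
  qed
  moreover have "norm (u i n) \<le> 8 * C * \<bar>F i\<bar>" for i n
  proof (cases "R i n")
    case True
    then have "n \<le> 2 * (n - i)" using R(1)[of i n] by linarith
    then have "\<bar>G (n - i)\<bar> \<le> C * (8 * catal n)"
      using GC[of "n - i"] mult_left_mono[OF catal_half C0] by fastforce
    then have "\<bar>F i\<bar> * \<bar>G (n - i)\<bar> \<le> \<bar>F i\<bar> * (C * (8 * catal n))"
      by (rule mult_left_mono) simp
    then show ?thesis using True by (simp add: u_def abs_mult divide_le_eq mult_ac)
  qed (use C0 in \<open>simp add: u_def\<close>)
  moreover have "summable (\<lambda>i. 8 * C * \<bar>F i\<bar>)"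
    using F by (rule summable_mult)
  ultimately have "(\<lambda>n. \<Sum>i. u i n) \<longlonglongrightarrow> (\<Sum>i. F i * m)"
    using tannerys_theorem[of u "\<lambda>i. F i * m" sequentially "\<lambda>i. 8 * C * \<bar>F i\<bar>"]
    by (simp add: case_prod_unfold)
  moreover have "(\<Sum>i. u i n) = (\<Sum>i | i \<le> n \<and> R i n. F i * G (n - i)) / catal n" for n
  proof -
    have "(\<Sum>i. u i n) = (\<Sum>i | i \<le> n \<and> R i n. u i n)"
    proof (rule suminf_finite)
      show "finite {i. i \<le> n \<and> R i n}" by simp
      show "u i n = 0" if "i \<notin> {i. i \<le> n \<and> R i n}" for i
      proof -
        have "\<not> R i n" using that R(1)[of i n] by auto
        then show ?thesis by (simp add: u_def)
      qed
    qed
    then show ?thesis by (simp add: u_def sum_divide_distrib)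
  qed
  moreover have "(\<Sum>i. F i * m) = m * suminf F"
    using suminf_mult2[OF summable_rabs_cancel[OF F], of m] by (simp add: mult.commute)
  ultimately show ?thesis by simp
qed

text \<open>In each product one index is at least n / 2. Splitting there gives two half sums, in
  each of which one factor contributes its limit and the other its full sum. One half is taken with
  a strict inequality so that i = n / 2 is counted once.\<close>

lemma convolution_limit:
  fixes F G :: "nat \<Rightarrow> real"
  assumes F: "summable (\<lambda>n. \<bar>F n\<bar>)" "(\<lambda>n. F n / catal n) \<longlonglongrightarrow> l"
    and G: "summable (\<lambda>n. \<bar>G n\<bar>)" "(\<lambda>n. G n / catal n) \<longlonglongrightarrow> m"
  shows "(\<lambda>n. (\<Sum>i\<le>n. F i * G (n - i)) / catal n) \<longlonglongrightarrow> l * suminf G + m * suminf F"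
proof -
  have "(\<lambda>n. (\<Sum>i | i \<le> n \<and> 2 * i \<le> n. F i * G (n - i)) / catal n) \<longlonglongrightarrow> m * suminf F"
    by (rule half_convolution_limit[OF F(1) G(2)])
      (auto intro: eventually_sequentiallyI[of "2 * i" for i])
  moreover have "(\<lambda>n. (\<Sum>i | i \<le> n \<and> 2 * i < n. G i * F (n - i)) / catal n) \<longlonglongrightarrow> l * suminf G"
    by (rule half_convolution_limit[OF G(1) F(2)])
      (auto intro: eventually_sequentiallyI[of "Suc (2 * i)" for i])
  moreover have "(\<Sum>i | i \<le> n \<and> 2 * i < n. G i * F (n - i))
      = (\<Sum>i | i \<le> n \<and> \<not> 2 * i \<le> n. F i * G (n - i))" for n
    by (rule sum.reindex_bij_witness[of _ "\<lambda>i. n - i" "\<lambda>i. n - i"]) auto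
  moreover have "(\<Sum>i\<le>n. F i * G (n - i)) = (\<Sum>i | i \<le> n \<and> 2 * i \<le> n. F i * G (n - i))
      + (\<Sum>i | i \<le> n \<and> \<not> 2 * i \<le> n. F i * G (n - i))" for n
    by (subst sum.union_disjoint[symmetric]) (auto intro!: sum.cong)
  ultimately show ?thesis
    by (simp add: add_divide_distrib add.commute[of "l * suminf G"] tendsto_add)
qed

section \<open>Values of power series and square-root singularities\<close>

definition abs_sums_at :: "real \<Rightarrow> real fps \<Rightarrow> real \<Rightarrow> bool" where
  "abs_sums_at z f v \<longleftrightarrow> summable (\<lambda>n. \<bar>fps_nth f n * z ^ n\<bar>) \<and> (\<lambda>n. fps_nth f n * z ^ n) sums v"

lemma abs_sums_at_finite:
  assumes "\<And>n. n > N \<Longrightarrow> fps_nth f n = 0"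
  shows "abs_sums_at z f (\<Sum>n\<le>N. fps_nth f n * z ^ n)"
  unfolding abs_sums_at_def
proof
  have zero: "fps_nth f n = 0" if "n \<notin> {..N}" for n using assms[of n] that by simp
  show "summable (\<lambda>n. \<bar>fps_nth f n * z ^ n\<bar>)"
    by (rule summable_finite[of "{..N}"]) (simp_all add: zero)
  show "(\<lambda>n. fps_nth f n * z ^ n) sums (\<Sum>n\<le>N. fps_nth f n * z ^ n)"
    by (rule sums_finite) (simp_all add: zero)
qed

lemma abs_sums_at_const: "abs_sums_at z (fps_const c) c"
  using abs_sums_at_finite[of 0 "fps_const c" z] by simp

lemma abs_sums_at_1: "abs_sums_at z 1 1"
  using abs_sums_at_const[of z 1] by simp

lemma abs_sums_at_X: "abs_sums_at z fps_X z"
  using abs_sums_at_finite[of 1 fps_X z] by simp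

lemma abs_sums_at_add: "abs_sums_at z f v \<Longrightarrow> abs_sums_at z g w \<Longrightarrow> abs_sums_at z (f + g) (v + w)"
  unfolding abs_sums_at_def fps_add_nth distrib_right
proof (elim conjE, intro conjI)
  assume "summable (\<lambda>n. \<bar>fps_nth f n * z ^ n\<bar>)" "summable (\<lambda>n. \<bar>fps_nth g n * z ^ n\<bar>)"
  from summable_add[OF this]
  show "summable (\<lambda>n. \<bar>fps_nth f n * z ^ n + fps_nth g n * z ^ n\<bar>)"
    by (rule summable_comparison_test') (auto intro: abs_triangle_ineq)
qed (rule sums_add)

lemma abs_sums_at_mult:
  assumes "abs_sums_at z f v" "abs_sums_at z g w"
  shows "abs_sums_at z (f * g) (v * w)"
proof -
  let ?F = "\<lambda>n. fps_nth f n * z ^ n" and ?G = "\<lambda>n. fps_nth g n * z ^ n"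
  have eq: "fps_nth (f * g) n * z ^ n = (\<Sum>i\<le>n. ?F i * ?G (n - i))" for n
    unfolding fps_mult_nth sum_distrib_right atLeast0AtMost
    by (intro sum.cong refl) (simp add: mult_ac flip: power_add)
  have F: "summable (\<lambda>n. norm (?F n))" "suminf ?F = v" and G: "summable (\<lambda>n. norm (?G n))" "suminf ?G = w"
    using assms by (auto simp: abs_sums_at_def sums_iff)
  have "summable (\<lambda>n. \<Sum>i\<le>n. norm (?F i) * norm (?G (n - i)))"
    using F(1) G(1) by (intro summable_Cauchy_product) simp_all
  then have "summable (\<lambda>n. \<bar>\<Sum>i\<le>n. ?F i * ?G (n - i)\<bar>)"
    by (rule summable_comparison_test') (auto simp: abs_mult intro: order.trans[OF sum_abs])
  then show ?thesis
    using Cauchy_product_sums[OF F(1) G(1)] F(2) G(2) unfolding abs_sums_at_def eq by simp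
qed

lemma abs_sums_at_cmult: "abs_sums_at z f v \<Longrightarrow> abs_sums_at z (fps_const c * f) (c * v)"
  by (intro abs_sums_at_mult abs_sums_at_const)

lemma abs_sums_at_diff:
  assumes "abs_sums_at z f v" "abs_sums_at z g w"
  shows "abs_sums_at z (f - g) (v - w)"
  using abs_sums_at_add[OF assms(1) abs_sums_at_cmult[OF assms(2), of "-1"]]
  by (simp add: fps_const_neg[symmetric] del: fps_const_neg)

lemma abs_sums_at_power: "abs_sums_at z f v \<Longrightarrow> abs_sums_at z (f ^ k) (v ^ k)"
  by (induction k) (auto intro: abs_sums_at_1 abs_sums_at_mult)

lemma abs_sums_at_unique: "abs_sums_at z f v \<Longrightarrow> abs_sums_at z f w \<Longrightarrow> v = w"
  by (auto simp: abs_sums_at_def intro: sums_unique2)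

text \<open>In \<open>sqrt_sing \<sigma> f v l\<close> the function behaves like \<open>v - 2 * l * sqrt (1 - \<sigma> * z)\<close>
  at its singularity \<open>1 / \<sigma>\<close>; in particular \<open>l = 0\<close> if its radius of convergence is larger.\<close>

definition sqrt_sing :: "real \<Rightarrow> real fps \<Rightarrow> real \<Rightarrow> real \<Rightarrow> bool" where
  "sqrt_sing \<sigma> f v l \<longleftrightarrow> abs_sums_at (1 / \<sigma>) f v \<and> (\<lambda>n. fps_nth f n / (\<sigma> ^ n * catal n)) \<longlonglongrightarrow> l"

lemma sqrt_sing_finite:
  assumes "abs_sums_at (1 / \<sigma>) f v" "\<And>n. n > N \<Longrightarrow> fps_nth f n = 0"
  shows "sqrt_sing \<sigma> f v 0"
  unfolding sqrt_sing_def using assms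
  by (auto intro!: tendsto_eventually eventually_sequentiallyI[of "Suc N"])

lemma sqrt_sing_const: "sqrt_sing \<sigma> (fps_const c) c 0"
  by (rule sqrt_sing_finite[of _ _ _ 0]) (auto intro: abs_sums_at_const)

lemma sqrt_sing_1: "sqrt_sing \<sigma> 1 1 0"
  using sqrt_sing_const[of \<sigma> 1] by simp

lemma sqrt_sing_X: "sqrt_sing \<sigma> fps_X (1 / \<sigma>) 0"
  by (rule sqrt_sing_finite[of _ _ _ 1]) (auto intro: abs_sums_at_X)

lemma sqrt_sing_add:
  "sqrt_sing \<sigma> f v l \<Longrightarrow> sqrt_sing \<sigma> g w m \<Longrightarrow> sqrt_sing \<sigma> (f + g) (v + w) (l + m)"
  by (auto simp: sqrt_sing_def add_divide_distrib intro: abs_sums_at_add tendsto_add)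

text \<open>The Leibniz rule for the singular coefficient: dividing the coefficients by
  \<open>\<sigma> ^ n\<close> is compatible with convolution and reduces it to
  \<open>convolution_limit\<close>.\<close>

lemma sqrt_sing_mult:
  assumes "\<sigma> > 0" and f: "sqrt_sing \<sigma> f v l" and g: "sqrt_sing \<sigma> g w m"
  shows "sqrt_sing \<sigma> (f * g) (v * w) (l * w + m * v)"
proof -
  let ?F = "\<lambda>n. fps_nth f n * (1 / \<sigma>) ^ n" and ?G = "\<lambda>n. fps_nth g n * (1 / \<sigma>) ^ n"
  have eq: "fps_nth (f * g) n * (1 / \<sigma>) ^ n = (\<Sum>i\<le>n. ?F i * ?G (n - i))" for n
    unfolding fps_mult_nth sum_distrib_right atLeast0AtMost
    by (intro sum.cong refl) (simp add: mult_ac flip: power_add)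
  have "(\<lambda>n. (\<Sum>i\<le>n. ?F i * ?G (n - i)) / catal n) \<longlonglongrightarrow> l * suminf ?G + m * suminf ?F"
    by (rule convolution_limit)
      (use f g in \<open>auto simp: sqrt_sing_def abs_sums_at_def power_one_over divide_simps\<close>)
  moreover have "suminf ?F = v" "suminf ?G = w"
    using f g by (auto simp: sqrt_sing_def abs_sums_at_def sums_iff)
  moreover have "(\<Sum>i\<le>n. ?F i * ?G (n - i)) / catal n = fps_nth (f * g) n / (\<sigma> ^ n * catal n)" for n
    unfolding eq[symmetric] by (simp add: power_one_over)
  ultimately show ?thesis
    using f g by (auto simp: sqrt_sing_def intro: abs_sums_at_mult)
qed

lemma sqrt_sing_cmult: "\<sigma> > 0 \<Longrightarrow> sqrt_sing \<sigma> f v l \<Longrightarrow> sqrt_sing \<sigma> (fps_const c * f) (c * v) (c * l)"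
  using sqrt_sing_mult[OF _ sqrt_sing_const[of \<sigma> c], of f v l] by (simp add: mult.commute)

lemma sqrt_sing_diff:
  assumes "\<sigma> > 0" "sqrt_sing \<sigma> f v l" "sqrt_sing \<sigma> g w m"
  shows "sqrt_sing \<sigma> (f - g) (v - w) (l - m)"
  using sqrt_sing_add[OF assms(2) sqrt_sing_cmult[OF assms(1,3), of "-1"]]
  by (simp add: fps_const_neg[symmetric] del: fps_const_neg)

lemma sqrt_sing_power:
  assumes "\<sigma> > 0" "sqrt_sing \<sigma> f v l"
  shows "sqrt_sing \<sigma> (f ^ k) (v ^ k) (real k * v ^ (k - 1) * l)"
proof (induction k)
  case 0
  then show ?case by (simp add: sqrt_sing_1)
next
  case (Suc k)
  have "l * v ^ k + real k * v ^ (k - 1) * l * v = real (Suc k) * v ^ (Suc k - 1) * l"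
    by (cases k) (simp_all add: algebra_simps)
  then show ?case
    using sqrt_sing_mult[OF assms Suc] by (simp only: power_Suc)
qed

section \<open>Coefficients of quotients by 1 - z\<close>

lemma tail_limit:
  fixes N h :: "nat \<Rightarrow> real"
  assumes h: "summable h" "\<And>n. 0 < h n" and lim: "(\<lambda>n. N n / h n) \<longlonglongrightarrow> l"
  shows "(\<lambda>n. (\<Sum>j. N (j + Suc n)) / (\<Sum>j. h (j + Suc n))) \<longlonglongrightarrow> l"
proof (rule LIMSEQ_I)
  fix e :: real assume "0 < e"
  have hs: "summable (\<lambda>j. h (j + n))" for n using h(1) by (simp add: summable_iff_shift)
  obtain n\<^sub>0 where n0: "\<And>n. n \<ge> n\<^sub>0 \<Longrightarrow> \<bar>N n / h n - l\<bar> < e / 2"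
    using LIMSEQ_D[OF lim, of "e / 2"] \<open>0 < e\<close> by auto
  show "\<exists>n\<^sub>0. \<forall>n\<ge>n\<^sub>0. norm ((\<Sum>j. N (j + Suc n)) / (\<Sum>j. h (j + Suc n)) - l) < e"
  proof (intro exI allI impI)
    fix n assume "n \<ge> n\<^sub>0"
    let ?h = "\<lambda>j. h (j + Suc n)" and ?N = "\<lambda>j. N (j + Suc n)"
    \<comment> \<open>A relative error bound on every term is inherited by the tail sums because
      \<open>h\<close> is positive; it also yields the summability of the tails of
      \<open>N\<close>.\<close>
    have b: "\<bar>?N j - l * ?h j\<bar> \<le> e / 2 * ?h j" for j
    proof -
      have "?N j - l * ?h j = (?N j / ?h j - l) * ?h j"
        using h(2)[of "j + Suc n"] by (simp add: field_simps)
      then show ?thesis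
        using n0[of "j + Suc n"] \<open>n \<ge> n\<^sub>0\<close> h(2)[of "j + Suc n"] by (simp add: abs_mult)
    qed
    have s: "summable (\<lambda>j. e / 2 * ?h j)" by (intro summable_mult hs)
    have ab: "summable (\<lambda>j. \<bar>?N j - l * ?h j\<bar>)"
      by (rule summable_comparison_test'[OF s]) (use b in simp)
    have "summable (\<lambda>j. (?N j - l * ?h j) + l * ?h j)"
      by (intro summable_add summable_mult hs summable_rabs_cancel[OF ab])
    then have Ns: "summable ?N" by simp
    have pos: "0 < suminf ?h" by (intro suminf_pos hs h(2))
    have "\<bar>suminf ?N - l * suminf ?h\<bar> = \<bar>\<Sum>j. ?N j - l * ?h j\<bar>"
      by (simp only: suminf_diff[OF Ns summable_mult[OF hs], symmetric] suminf_mult[OF hs])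
    also have "\<dots> \<le> (\<Sum>j. \<bar>?N j - l * ?h j\<bar>)" by (rule summable_rabs[OF ab])
    also have "\<dots> \<le> (\<Sum>j. e / 2 * ?h j)" by (rule suminf_le[OF b ab s])
    also have "\<dots> = e / 2 * suminf ?h" by (rule suminf_mult[OF hs])
    also have "\<dots> < e * suminf ?h" using \<open>0 < e\<close> pos by simp
    finally have "\<bar>suminf ?N - l * suminf ?h\<bar> / suminf ?h < e"
      using pos by (simp add: divide_less_eq)
    moreover have "suminf ?N / suminf ?h - l = (suminf ?N - l * suminf ?h) / suminf ?h"
      using pos by (simp add: field_simps)
    ultimately show "norm (suminf ?N / suminf ?h - l) < e"
      using pos by simp
  qed
qed

lemma partial_sums_fps:
  fixes E N :: "real fps"
  assumes "(1 - fps_X) * E = N"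
  shows "fps_nth E n = (\<Sum>j\<le>n. fps_nth N j)"
proof (induction n)
  case 0
  then show ?case unfolding assms[symmetric] by simp
next
  case (Suc n)
  have "fps_nth E (Suc n) = fps_nth E n + fps_nth N (Suc n)"
    unfolding assms[symmetric] by (simp add: left_diff_distrib)
  then show ?case using Suc by simp
qed

lemma limit_simple_pole:
  assumes "(1 - fps_X) * E = N" "abs_sums_at 1 N v"
  shows "fps_nth E \<longlonglongrightarrow> v"
proof -
  have "(\<lambda>n. \<Sum>j\<le>n. fps_nth N j) \<longlonglongrightarrow> v"
    using assms(2) by (simp add: abs_sums_at_def sums_def_le)
  moreover have "fps_nth E = (\<lambda>n. \<Sum>j\<le>n. fps_nth N j)"
    using partial_sums_fps[OF assms(1)] by (intro ext)
  ultimately show ?thesis by simp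
qed

text \<open>Since the numerators vanish at \<open>1\<close>, the coefficients of the quotients by \<open>1 - z\<close> are
  negated tails of convergent series.\<close>

lemma limit_ratio_cancelled_pole:
  assumes "0 < \<sigma>" "\<sigma> \<le> 1"
    and E: "(1 - fps_X) * E = N" "abs_sums_at 1 N 0" "sqrt_sing \<sigma> N v l" "l \<noteq> 0"
    and E': "(1 - fps_X) * E' = M" "abs_sums_at 1 M 0" "sqrt_sing \<sigma> M w m"
  shows "(\<lambda>n. fps_nth E' n / fps_nth E n) \<longlonglongrightarrow> m / l"
proof -
  define h where "h = (\<lambda>n. \<sigma> ^ n * catal n)"
  have h_pos: "0 < h n" for n using assms(1) by (simp add: h_def)
  have h_sum: "summable h"
  proof (rule summable_comparison_test'[OF summable_catal])
    show "norm (h n) \<le> catal n" for n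
      using assms(1,2) power_le_one[of \<sigma> n] by (simp add: h_def abs_mult mult_left_le_one_le less_imp_le)
  qed
  let ?T = "\<lambda>f n. \<Sum>j. f (j + Suc n) :: real"
  have tail: "fps_nth E n = - ?T (fps_nth N) n"
    if "(1 - fps_X) * E = N" "abs_sums_at 1 N 0" for E N n
  proof -
    have "fps_nth N sums 0" using that(2) by (simp add: abs_sums_at_def)
    then have "0 = ?T (fps_nth N) n + (\<Sum>j<Suc n. fps_nth N j)"
      using suminf_split_initial_segment[of "fps_nth N" "Suc n"] by (simp add: sums_iff)
    then show ?thesis using partial_sums_fps[OF that(1), of n] by (simp add: lessThan_Suc_atMost)
  qed
  have "(\<lambda>n. ?T (fps_nth N) n / ?T h n) \<longlonglongrightarrow> l" "(\<lambda>n. ?T (fps_nth M) n / ?T h n) \<longlonglongrightarrow> m"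
    by (intro tail_limit h_sum h_pos; use E(3) E'(3) in \<open>simp add: sqrt_sing_def h_def\<close>)+
  from tendsto_divide[OF this(2,1) E(4)]
  have "(\<lambda>n. (?T (fps_nth M) n / ?T h n) / (?T (fps_nth N) n / ?T h n)) \<longlonglongrightarrow> m / l" .
  moreover have "?T h n \<noteq> 0" for n
  proof -
    have "summable (\<lambda>j. h (j + Suc n))" using h_sum by (rule summable_ignore_initial_segment)
    from suminf_pos[OF this h_pos] show ?thesis by linarith
  qed
  ultimately show ?thesis
    using tail[OF E(1,2)] tail[OF E'(1,2)] by simp
qed

section \<open>The Catalan series: functional equation, values, singularities\<close>

definition catalan_fps :: "real \<Rightarrow> real fps" where
  "catalan_fps x = Abs_fps (\<lambda>n. (4 * x) ^ n * catal n)"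

text \<open>These are the coefficients of sqrt(1 - z) after the constant one.\<close>

lemma catal_gbinomial: "((1/2) gchoose Suc n) * (- 1) ^ Suc n = - catal n / 2"
proof (induction n)
  case (Suc n)
  have "((1/2 :: real) gchoose Suc (Suc n)) * (- 1) ^ Suc (Suc n)
      = ((1/2) gchoose Suc n) * (- 1) ^ Suc n * ((real n + 1 / 2) / (real n + 2))"
    by (simp only: gbinomial_Suc_rec) (simp add: field_simps)
  also have "\<dots> = - catal n / 2 * ((real n + 1 / 2) / (real n + 2))"
    unfolding Suc ..
  also have "\<dots> = - catal (Suc n) / 2"
    by (simp add: field_simps)
  finally show ?case .
qed simp

text \<open>With K the series of \<open>catal\<close>, sqrt(1 - z) = 1 - z K / 2. Squaring and
  cancelling z gives the equation at x = 1/4, and substituting 4 x z for z gives the general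
  one.\<close>

lemma catalan_fps_eq: "catalan_fps x = 1 + fps_const x * fps_X * catalan_fps x ^ 2"
proof -
  let ?K = "Abs_fps catal"
  define s where "s = fps_binomial (1/2) oo (- fps_X :: real fps)"
  have s_eq: "s = 1 - fps_const (1/2) * fps_X * ?K"
  proof (rule fps_ext)
    fix n
    show "fps_nth s n = fps_nth (1 - fps_const (1/2) * fps_X * ?K) n"
    proof (cases n)
      case (Suc m)
      then show ?thesis
        using catal_gbinomial[of m] by (simp add: s_def fps_compose_uminus' mult.assoc) (simp add: mult_ac)
    qed (simp add: s_def fps_compose_uminus' mult.assoc)
  qed
  have "s ^ 2 = fps_binomial 1 oo (- fps_X)"
    unfolding s_def by (simp add: fps_compose_power fps_binomial_power)
  also have "\<dots> = 1 - fps_X"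
    by (simp add: fps_binomial_1 fps_compose_add_distrib fps_X_fps_compose_startby0)
  finally have "s ^ 2 = 1 - fps_X" .
  then have "fps_X * ?K = fps_X * (1 + fps_const (1/4) * fps_X * ?K ^ 2)"
  proof -
    have "(1 - h * X * k)\<^sup>2 = 1 - X \<Longrightarrow> 2 * h = 1 \<Longrightarrow> h * h = q \<Longrightarrow> X * k = X * (1 + q * X * k ^ 2)"
      for h X k q :: "real fps" by algebra
    from this[of "fps_const (1/2)" fps_X ?K "fps_const (1/4)"] \<open>s ^ 2 = 1 - fps_X\<close>
    show ?thesis unfolding s_eq by (simp add: numeral_fps_const)
  qed
  then have K: "?K = 1 + fps_const (1/4) * fps_X * ?K ^ 2"
    by simp
  let ?L = "fps_const (4 * x) * fps_X :: real fps"
  have "catalan_fps x = ?K oo ?L"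
    by (rule fps_ext) (simp add: catalan_fps_def)
  also have "\<dots> = (1 + fps_const (1/4) * fps_X * ?K ^ 2) oo ?L"
    by (rule arg_cong[OF K])
  also have "\<dots> = 1 + fps_const (1/4) * ?L * (?K oo ?L) ^ 2"
    by (simp add: fps_compose_add_distrib fps_compose_mult_distrib fps_compose_power
        fps_X_fps_compose_startby0)
  also have "?K oo ?L = catalan_fps x"
    by (rule fps_ext) (simp add: catalan_fps_def)
  also have "fps_const (1/4) * ?L = fps_const x * fps_X"
    by (simp flip: mult.assoc)
  finally show ?thesis .
qed

definition first_return :: "real \<Rightarrow> real fps" where
  "first_return x = fps_const x * fps_X * catalan_fps x"

lemma catalan_first_return: "(1 - first_return x) * catalan_fps x = 1"
proof -
  have "c = 1 + u * X * c ^ 2 \<Longrightarrow> (1 - u * X * c) * c = 1" for c u X :: "real fps"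
    by algebra
  from this[OF catalan_fps_eq] show ?thesis by (simp add: first_return_def)
qed

text \<open>The bound, uniform in x and z, serves to select the right root of the quadratic equation
  in \<open>first_return_sums\<close>.\<close>

lemma catalan_sums:
  assumes "0 \<le> x" "0 \<le> z" "4 * x * z \<le> 1"
  shows "\<exists>v. abs_sums_at z (catalan_fps x) v \<and> v \<le> suminf catal"
proof -
  have b: "\<bar>fps_nth (catalan_fps x) n * z ^ n\<bar> \<le> catal n" for n
  proof -
    have "fps_nth (catalan_fps x) n * z ^ n = (4 * x * z) ^ n * catal n"
      by (simp add: catalan_fps_def power_mult_distrib)
    moreover have "0 \<le> (4 * x * z) ^ n" "(4 * x * z) ^ n \<le> 1"
      using assms by (simp_all add: power_le_one)
    ultimately show ?thesis
      using mult_left_le_one_le[of "catal n" "(4 * x * z) ^ n"] catal_pos[of n] by (simp add: abs_mult less_imp_le)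
  qed
  have s: "summable (\<lambda>n. \<bar>fps_nth (catalan_fps x) n * z ^ n\<bar>)"
    by (rule summable_comparison_test'[OF summable_catal]) (use b in simp)
  have "(\<Sum>n. fps_nth (catalan_fps x) n * z ^ n) \<le> suminf catal"
    by (rule suminf_le[OF _ summable_rabs_cancel[OF s] summable_catal]) (use b in \<open>simp add: abs_le_iff\<close>)
  then show ?thesis
    using s summable_rabs_cancel[OF s] by (auto simp: abs_sums_at_def summable_sums)
qed

lemma first_return_sums:
  assumes "0 \<le> x" "0 \<le> z" "4 * x * z \<le> 1"
  shows "abs_sums_at z (first_return x) ((1 - sqrt (1 - 4 * x * z)) / 2)"
proof -
  have value_eq: "(1 - 2 * (x * z * v)) ^ 2 = 1 - 4 * x * z"
    if "abs_sums_at z (catalan_fps x) v" for x z v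
  proof -
    have "abs_sums_at z (1 + fps_const x * fps_X * catalan_fps x ^ 2) (1 + x * z * v ^ 2)"
      by (intro abs_sums_at_add abs_sums_at_mult abs_sums_at_power that abs_sums_at_1
          abs_sums_at_const abs_sums_at_X)
    with that have "v = 1 + x * z * v ^ 2"
      using abs_sums_at_unique catalan_fps_eq by metis
    then show ?thesis by algebra
  qed
  obtain v where v: "abs_sums_at z (catalan_fps x) v" "v \<le> suminf catal"
    using catalan_sums assms by blast
  \<comment> \<open>At x = 1/4 and z = 1 the discriminant vanishes, so the sum of
    \<open>catal\<close> must be 2. Hence x z v <= 1/2 in general, which makes 1 - 2 x z v the
    nonnegative root.\<close>
  have "catalan_fps (1/4) = Abs_fps catal" by (simp add: catalan_fps_def)
  then have "abs_sums_at 1 (catalan_fps (1/4)) (suminf catal)"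
    using summable_catal by (simp add: abs_sums_at_def summable_sums less_imp_le)
  from value_eq[OF this] have "suminf catal = 2" by simp
  then have "x * z * v \<le> 1 / 4 * 2"
    using v(2) assms mult_left_mono[of v 2 "x * z"] by simp
  then have "1 - 2 * (x * z * v) = sqrt (1 - 4 * x * z)"
    using value_eq[OF v(1)] by (intro real_sqrt_unique[symmetric]) auto
  then have "(1 - sqrt (1 - 4 * x * z)) / 2 = x * z * v" by simp
  then show ?thesis
    unfolding first_return_def
    by (simp only:) (intro abs_sums_at_mult v(1) abs_sums_at_const abs_sums_at_X)
qed

lemma catalan_fps_sums:
  assumes "0 \<le> x" "0 \<le> z" "4 * x * z \<le> 1" and w: "w = (1 - sqrt (1 - 4 * x * z)) / 2"
  shows "abs_sums_at z (catalan_fps x) (1 / (1 - w))"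
proof -
  obtain v where v: "abs_sums_at z (catalan_fps x) v"
    using catalan_sums assms by blast
  have "abs_sums_at z (first_return x) w"
    unfolding w using assms by (intro first_return_sums)
  then have "abs_sums_at z ((1 - first_return x) * catalan_fps x) ((1 - w) * v)"
    by (intro abs_sums_at_mult abs_sums_at_diff v abs_sums_at_1)
  then have "(1 - w) * v = 1"
    unfolding catalan_first_return using abs_sums_at_1 abs_sums_at_unique by blast
  then have "v = 1 / (1 - w)" by (metis mult_zero_left nonzero_eq_divide_eq mult.commute zero_neq_one)
  then show ?thesis using v by simp
qed

lemma sqrt_one_minus_four: "sqrt (1 - 4 * (a * (1 - a))) = \<bar>1 - 2 * a\<bar>" for a :: real
proof -
  have "1 - 4 * (a * (1 - a)) = (1 - 2 * a) ^ 2" by (simp add: power2_eq_square algebra_simps)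
  then show ?thesis by simp
qed

lemma four_mult_le_1: "4 * (a * (1 - a)) \<le> 1" for a :: real
proof -
  have "0 \<le> (1 - 2 * a) ^ 2" by simp
  also have "\<dots> = 1 - 4 * (a * (1 - a))" by (simp add: power2_eq_square algebra_simps)
  finally show ?thesis by simp
qed

text \<open>At z = 1 the discriminant is the square of 1 - 2a, and its root in absolute value
  produces the minimum.\<close>

lemma first_return_sums_at_1:
  assumes "0 \<le> a" "a \<le> 1"
  shows "abs_sums_at 1 (first_return (a * (1 - a))) (min a (1 - a))"
proof -
  have "(1 - sqrt (1 - 4 * (a * (1 - a)) * 1)) / 2 = min a (1 - a)"
    using sqrt_one_minus_four[of a] by (auto simp: min_def abs_if field_simps)
  then show ?thesis
    using first_return_sums[of "a * (1 - a)" 1] assms four_mult_le_1[of a] by simp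
qed

lemma catalan_fps_sums_at_1:
  assumes "0 \<le> a" "a \<le> 1"
  shows "abs_sums_at 1 (catalan_fps (a * (1 - a))) (1 / max a (1 - a))"
proof -
  have "1 - (1 - sqrt (1 - 4 * (a * (1 - a)) * 1)) / 2 = max a (1 - a)"
    using sqrt_one_minus_four[of a] by (auto simp: max_def abs_if field_simps)
  then show ?thesis
    using catalan_fps_sums[of "a * (1 - a)" 1, OF _ _ _ refl] assms four_mult_le_1[of a] by simp
qed

lemma catalan_fps_sing:
  assumes "0 < x"
  shows "sqrt_sing (4 * x) (catalan_fps x) 2 1"
proof -
  have "abs_sums_at (1 / (4 * x)) (catalan_fps x) 2"
    using catalan_fps_sums[of x "1 / (4 * x)" "1/2"] assms by simp
  moreover have "(\<lambda>n. fps_nth (catalan_fps x) n / ((4 * x) ^ n * catal n)) = (\<lambda>_. 1)"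
    using assms by (simp add: catalan_fps_def)
  ultimately show ?thesis by (simp add: sqrt_sing_def)
qed

text \<open>Relative to the comparison sequence the coefficients are exactly the powers of 4x /
  \<open>\<sigma>\<close>, a ratio below 1.\<close>

lemma catalan_fps_no_sing:
  assumes "0 \<le> x" "4 * x < \<sigma>" and w: "w = (1 - sqrt (1 - 4 * x / \<sigma>)) / 2"
  shows "sqrt_sing \<sigma> (catalan_fps x) (1 / (1 - w)) 0"
proof -
  have "0 < \<sigma>" using assms by linarith
  then have "abs_sums_at (1 / \<sigma>) (catalan_fps x) (1 / (1 - w))"
    using assms by (intro catalan_fps_sums) auto
  moreover have "(\<lambda>n. (4 * x / \<sigma>) ^ n) \<longlonglongrightarrow> 0"
    using assms \<open>0 < \<sigma>\<close> by (intro LIMSEQ_power_zero) auto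
  moreover have "fps_nth (catalan_fps x) n / (\<sigma> ^ n * catal n) = (4 * x / \<sigma>) ^ n" for n
    using catal_pos[of n] \<open>0 < \<sigma>\<close> by (simp add: catalan_fps_def power_divide)
  ultimately show ?thesis by (simp add: sqrt_sing_def)
qed

lemma first_return_sing:
  assumes "0 < x"
  shows "sqrt_sing (4 * x) (first_return x) (1/2) (1/4)"
  using sqrt_sing_cmult[OF _ sqrt_sing_mult[OF _ sqrt_sing_X catalan_fps_sing[OF assms]], of x] assms
  by (simp add: first_return_def mult.assoc)

lemma first_return_no_sing:
  assumes "0 \<le> x" "4 * x < \<sigma>"
  shows "sqrt_sing \<sigma> (first_return x) ((1 - sqrt (1 - 4 * x / \<sigma>)) / 2) 0"
proof -
  have "0 < \<sigma>" using assms by linarith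
  obtain v where v: "sqrt_sing \<sigma> (catalan_fps x) v 0"
    using catalan_fps_no_sing assms by blast
  from sqrt_sing_cmult[OF \<open>0 < \<sigma>\<close> sqrt_sing_mult[OF \<open>0 < \<sigma>\<close> sqrt_sing_X v], of x]
  have "(\<lambda>n. fps_nth (first_return x) n / (\<sigma> ^ n * catal n)) \<longlonglongrightarrow> 0"
    by (simp add: sqrt_sing_def first_return_def mult.assoc)
  moreover have "abs_sums_at (1 / \<sigma>) (first_return x) ((1 - sqrt (1 - 4 * x / \<sigma>)) / 2)"
    using first_return_sums[of x "1 / \<sigma>"] assms \<open>0 < \<sigma>\<close> by simp
  ultimately show ?thesis by (simp add: sqrt_sing_def)
qed

section \<open>Limits of the return probabilities\<close>

text \<open>If the step \<open>{-1}\<close> from the reachable set \<open>{0}\<close> led to \<open>{1}\<close> instead of killing the walk,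
  the minimum of the reachable set would be a reflected random walk with first-return generating
  function \<open>H = min_return b\<close>, and \<open>1 / (1 - H)\<close> would count the walks with minimum \<open>0\<close>.
  Subtracting the killed walks gives \<open>E = (1 - a H P) / (1 - H)\<close>.\<close>

definition min_return :: "real \<Rightarrow> real fps" where
  "min_return b = fps_const (1 - b) * fps_X * catalan_fps (b * (1 - b))"

definition excursion_gf :: "real \<Rightarrow> real \<Rightarrow> real fps" where
  "excursion_gf a b = (1 - fps_const a * (min_return b * catalan_fps (a * (1 - a))))
     * inverse (1 - min_return b)"

definition excursion_numerator :: "real \<Rightarrow> real \<Rightarrow> real fps" where
  "excursion_numerator a b = (1 - fps_const a * (min_return b * catalan_fps (a * (1 - a))))
     * (1 - fps_const (b / (1 - b)) * min_return b)"

lemma min_return_nth_0 [simp]: "fps_nth (min_return b) 0 = 0"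
  by (simp add: min_return_def mult.assoc)

lemma excursion_gf_eq:
  "(1 - min_return b) * excursion_gf a b
   = 1 - fps_const a * (min_return b * catalan_fps (a * (1 - a)))"
proof -
  have "(1 - min_return b) * inverse (1 - min_return b) = 1"
    by (rule inverse_mult_eq_1') simp
  then show ?thesis unfolding excursion_gf_def by (metis mult.left_commute mult.right_neutral)
qed

lemma first_return_min_return: "first_return (b * (1 - b)) = fps_const b * min_return b"
  by (simp add: first_return_def min_return_def flip: mult.assoc)

lemma min_return_quadratic:
  "min_return b = fps_const (1 - b) * fps_X + fps_const b * min_return b ^ 2"
proof -
  have "c = 1 + u * v * X * c ^ 2 \<Longrightarrow> v * X * c = v * X + u * (v * X * c) ^ 2" for c u v X :: "real fps"
    by algebra
  from this[of _ "fps_const b" "fps_const (1 - b)"] catalan_fps_eq[of "b * (1 - b)"]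
  show ?thesis by (simp add: min_return_def)
qed

text \<open>By \<open>min_return_quadratic\<close>, the product of 1 - H and (1 - b) - b H collapses
  to (1 - b) (1 - z); divide by 1 - b.\<close>

lemma one_minus_min_return:
  assumes "b \<noteq> 1"
  shows "(1 - min_return b) * (1 - fps_const (b / (1 - b)) * min_return b) = 1 - fps_X"
proof -
  have "(1 - h) * (1 - \<beta> * h) = 1 - X"
    if "h = u * X + w * h ^ 2" "u * \<beta> = w" "u * v = 1" "u + w = 1" for h \<beta> u v w X :: "real fps"
    using that by algebra
  from this[where \<beta> = "fps_const (b / (1 - b))" and v = "fps_const (1 / (1 - b))",
      OF min_return_quadratic]
  show ?thesis using assms by simp
qed

lemma one_minus_X_excursion_gf:
  assumes "b \<noteq> 1"
  shows "(1 - fps_X) * excursion_gf a b = excursion_numerator a b"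
proof -
  have "(1 - fps_X) * excursion_gf a b = (1 - fps_const (b / (1 - b)) * min_return b)
      * ((1 - min_return b) * excursion_gf a b)"
    unfolding one_minus_min_return[OF assms, symmetric] by (simp only: mult_ac)
  then show ?thesis unfolding excursion_gf_eq excursion_numerator_def by (simp only: mult_ac)
qed

lemma one_minus_X_returns:
  assumes "b \<noteq> 1"
  shows "(1 - fps_X) * (V * excursion_gf a b) = V * excursion_numerator a b"
  using one_minus_X_excursion_gf[OF assms] by (metis mult.left_commute)

text \<open>Here every step is a singleton, so the reachable set is at most one point and an
  excursion always ends with the set \<open>{0}\<close>. Algebraically, P solves the equation of E,
  and 1 - H can be cancelled.\<close>

lemma excursion_gf_classical:
  assumes "a + b = 1"
  shows "excursion_gf a b = catalan_fps (a * (1 - a))"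
proof -
  let ?P = "catalan_fps (a * (1 - a))"
  have b: "b = 1 - a" using assms by simp
  have "c = 1 + u * v * X * c ^ 2 \<Longrightarrow> u + v = 1 \<Longrightarrow>
      (1 - u * X * c) * c = 1 - u * (u * X * c * c)" for c u v X :: "real fps"
    by algebra
  from this[of ?P "fps_const a" "fps_const (1 - a)" fps_X] catalan_fps_eq[of "a * (1 - a)"]
  have "(1 - min_return b) * ?P = 1 - fps_const a * (min_return b * ?P)"
    by (simp add: min_return_def b mult.commute[of "1 - a"])
  then have "(1 - min_return b) * (excursion_gf a b - ?P) = 0"
    by (simp add: right_diff_distrib excursion_gf_eq)
  moreover have "fps_nth (1 - min_return b) 0 \<noteq> fps_nth 0 0" by simp
  then have "1 - min_return b \<noteq> 0" by metis
  ultimately show ?thesis by (simp only: mult_eq_0_iff) simp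
qed

text \<open>The value is 1 for b <= 1/2, where the reflected minimum is recurrent, and (1 - b) / b
  otherwise.\<close>

lemma min_return_sums_at_1:
  assumes "0 \<le> b" "b < 1"
  shows "abs_sums_at 1 (min_return b) ((1 - b) / max b (1 - b))"
proof -
  have "abs_sums_at 1 (min_return b) ((1 - b) * 1 * (1 / max b (1 - b)))"
    unfolding min_return_def using assms
    by (intro abs_sums_at_mult abs_sums_at_const abs_sums_at_X catalan_fps_sums_at_1) auto
  then show ?thesis by simp
qed

lemma excursion_numerator_sums:
  assumes "abs_sums_at z (catalan_fps (a * (1 - a))) c" "abs_sums_at z (min_return b) h"
  shows "abs_sums_at z (excursion_numerator a b) ((1 - a * (h * c)) * (1 - b / (1 - b) * h))"
  unfolding excursion_numerator_def
  by (intro abs_sums_at_mult abs_sums_at_diff abs_sums_at_1 abs_sums_at_const assms)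

lemma excursion_numerator_sing:
  assumes "0 < \<sigma>" "sqrt_sing \<sigma> (catalan_fps (a * (1 - a))) c l" "sqrt_sing \<sigma> (min_return b) h m"
  shows "sqrt_sing \<sigma> (excursion_numerator a b) ((1 - a * (h * c)) * (1 - b / (1 - b) * h))
    (- (a * (m * c + l * h)) * (1 - b / (1 - b) * h) - b / (1 - b) * m * (1 - a * (h * c)))"
proof -
  have "sqrt_sing \<sigma> (excursion_numerator a b) ((1 - a * (h * c)) * (1 - b / (1 - b) * h))
    ((0 - a * (m * c + l * h)) * (1 - b / (1 - b) * h) + (0 - b / (1 - b) * m) * (1 - a * (h * c)))"
    unfolding excursion_numerator_def
    by (intro sqrt_sing_mult sqrt_sing_diff sqrt_sing_cmult sqrt_sing_1 assms)
  then show ?thesis by simp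
qed

lemma returns_sums:
  assumes "abs_sums_at z (first_return x) w"
  shows "abs_sums_at z (first_return x ^ k * (1 - first_return x)) (w ^ k * (1 - w))"
  by (intro abs_sums_at_mult abs_sums_at_power abs_sums_at_diff abs_sums_at_1 assms)

lemma returns_sing:
  assumes "0 < \<sigma>" "sqrt_sing \<sigma> (first_return x) w l"
  shows "sqrt_sing \<sigma> (first_return x ^ k * (1 - first_return x)) (w ^ k * (1 - w))
    (real k * w ^ (k - 1) * l * (1 - w) - l * w ^ k)"
proof -
  have "sqrt_sing \<sigma> (first_return x ^ k * (1 - first_return x)) (w ^ k * (1 - w))
      (real k * w ^ (k - 1) * l * (1 - w) + (0 - l) * w ^ k)"
    by (intro sqrt_sing_mult sqrt_sing_power sqrt_sing_diff sqrt_sing_1 assms)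
  then show ?thesis by simp
qed

text \<open>The derivative of w^k (1 - w) at w = 1/2, times 1/4: these are the value and the
  singular coefficient of the first-return series at its own singularity.\<close>

lemma half_power_derivative:
  "real k * (1/2) ^ (k - 1) * (1/4) * (1 - 1/2) - 1/4 * (1/2) ^ k = (real k - 1) / (2 * 2 ^ (k + 1) :: real)"
  by (cases k) (simp_all add: field_simps)

definition return_prob :: "real \<Rightarrow> real \<Rightarrow> nat \<Rightarrow> nat \<Rightarrow> real" where
  "return_prob a b n k = fps_nth (first_return (a * (1 - a)) ^ k * (1 - first_return (a * (1 - a)))
     * excursion_gf a b) n / fps_nth (excursion_gf a b) n"

text \<open>The hypothesis \<open>zero\<close> says that the pole of the excursions at \<open>z = 1\<close> cancels.\<close>

lemma return_prob_limit:
  assumes b: "0 \<le> b" "b < 1" and a: "0 \<le> a" "a \<le> 1" and \<sigma>: "0 < \<sigma>" "\<sigma> \<le> 1"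
    and zero: "(1 - a * ((1 - b) / max b (1 - b) * (1 / max a (1 - a))))
               * (1 - b / (1 - b) * ((1 - b) / max b (1 - b))) = 0"
    and c: "sqrt_sing \<sigma> (catalan_fps (a * (1 - a))) c l" and h: "sqrt_sing \<sigma> (min_return b) h m"
    and w: "sqrt_sing \<sigma> (first_return (a * (1 - a))) w l\<^sub>w"
    and d: "d = - (a * (m * c + l * h)) * (1 - b / (1 - b) * h) - b / (1 - b) * m * (1 - a * (h * c))"
      "d \<noteq> 0"
  shows "(\<lambda>n. return_prob a b n k) \<longlonglongrightarrow> w ^ k * (1 - w)
    + (real k * w ^ (k - 1) * l\<^sub>w * (1 - w) - l\<^sub>w * w ^ k)
      * ((1 - a * (h * c)) * (1 - b / (1 - b) * h)) / d"
proof -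
  let ?x = "a * (1 - a)"
  let ?V = "first_return ?x ^ k * (1 - first_return ?x)"
  let ?v = "w ^ k * (1 - w)" and ?l = "real k * w ^ (k - 1) * l\<^sub>w * (1 - w) - l\<^sub>w * w ^ k"
  let ?N = "(1 - a * (h * c)) * (1 - b / (1 - b) * h)"
  have N1: "abs_sums_at 1 (excursion_numerator a b) 0"
    using excursion_numerator_sums[OF catalan_fps_sums_at_1[OF a] min_return_sums_at_1[OF b]]
    unfolding zero .
  have M1: "abs_sums_at 1 (?V * excursion_numerator a b) 0"
    using abs_sums_at_mult[OF returns_sums[OF first_return_sums_at_1[OF a]] N1] by simp
  have N: "sqrt_sing \<sigma> (excursion_numerator a b) ?N d"
    using excursion_numerator_sing[OF \<sigma>(1) c h] d by simp
  have M: "sqrt_sing \<sigma> (?V * excursion_numerator a b) (?v * ?N) (?l * ?N + d * ?v)"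
    by (intro sqrt_sing_mult returns_sing \<sigma> w N)
  have "b \<noteq> 1" using b by simp
  have "(\<lambda>n. return_prob a b n k) \<longlonglongrightarrow> (?l * ?N + d * ?v) / d"
    unfolding return_prob_def
    by (rule limit_ratio_cancelled_pole[OF \<sigma> one_minus_X_excursion_gf[OF \<open>b \<noteq> 1\<close>] N1 N d(2)
          one_minus_X_returns[OF \<open>b \<noteq> 1\<close>] M1 M])
  then show ?thesis using d(2) by (simp add: add_divide_distrib add.commute)
qed

text \<open>Here H(1) = 1 and P(1) = 1 / (1 - a), so both factors of N(1) are positive and N(1)
  cancels in the quotient.\<close>

lemma return_prob_limit_pole:
  assumes "0 \<le> a" "a < 1/2" "0 \<le> b" "b < 1/2"
  shows "(\<lambda>n. return_prob a b n k) \<longlonglongrightarrow> (1 - a) * a ^ k"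
proof -
  let ?x = "a * (1 - a)"
  let ?V = "first_return ?x ^ k * (1 - first_return ?x)"
  define v where "v = (1 - a / (1 - a)) * (1 - b / (1 - b))"
  have "0 < v" unfolding v_def using assms by (intro mult_pos_pos) (simp_all add: field_simps)
  then have "v \<noteq> 0" by simp
  have c: "abs_sums_at 1 (catalan_fps ?x) (1 / (1 - a))"
    using catalan_fps_sums_at_1[of a] assms by (simp add: max_def)
  have h: "abs_sums_at 1 (min_return b) 1"
    using min_return_sums_at_1[of b] assms by (simp add: max_def)
  have w: "abs_sums_at 1 (first_return ?x) a"
    using first_return_sums_at_1[of a] assms by (simp add: min_def)
  have N: "abs_sums_at 1 (excursion_numerator a b) v"
    using excursion_numerator_sums[OF c h] by (simp add: v_def)
  have b1: "b \<noteq> 1" using assms by simp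
  have "(\<lambda>n. return_prob a b n k) \<longlonglongrightarrow> (a ^ k * (1 - a) * v) / v"
    unfolding return_prob_def
    by (intro tendsto_divide limit_simple_pole[OF one_minus_X_returns[OF b1]]
        limit_simple_pole[OF one_minus_X_excursion_gf[OF b1]] abs_sums_at_mult returns_sums w N \<open>v \<noteq> 0\<close>)
  then show ?thesis using \<open>v \<noteq> 0\<close> by (simp add: mult.commute)
qed

lemma min_return_sing:
  assumes "0 < b" "b < 1"
  shows "sqrt_sing (4 * (b * (1 - b))) (min_return b) (1 / (2 * b)) (1 / (4 * b))"
proof -
  have "0 < b * (1 - b)" using assms by simp
  then have "0 < 4 * (b * (1 - b))" by simp
  from sqrt_sing_cmult[OF this first_return_sing[OF \<open>0 < b * (1 - b)\<close>], of "1 / b"]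
  have "sqrt_sing (4 * (b * (1 - b))) (fps_const (1 / b) * (fps_const b * min_return b))
      (1 / b * (1/2)) (1 / b * (1/4))"
    by (simp only: first_return_min_return)
  moreover have "fps_const (1 / b) * (fps_const b * min_return b) = min_return b"
    using assms by (simp flip: mult.assoc)
  ultimately show ?thesis by (simp add: mult.commute)
qed

text \<open>H has the nearer singularity, since b (1 - b) - a (1 - a) = (b - a) (1 - a - b) > 0.
  There P and the first-return series are regular, so the correction term of
  \<open>return_prob_limit\<close> vanishes and a geometric law remains.\<close>

lemma return_prob_limit_sqrt_b:
  assumes "0 \<le> a" "a < 1/2" "1/2 \<le> b" "a + b < 1"
    and \<sigma>: "\<sigma> = 4 * (b * (1 - b))" and w: "w = (1 - sqrt (1 - 4 * (a * (1 - a)) / \<sigma>)) / 2"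
  shows "4 * (a * (1 - a)) < \<sigma>" "(\<lambda>n. return_prob a b n k) \<longlonglongrightarrow> (1 - w) * w ^ k"
proof -
  have "b * (1 - b) - a * (1 - a) = (b - a) * (1 - a - b)" by (simp add: algebra_simps)
  moreover have "0 < (b - a) * (1 - a - b)" using assms by (intro mult_pos_pos) auto
  ultimately show lt: "4 * (a * (1 - a)) < \<sigma>" unfolding \<sigma> by linarith
  have "0 \<le> a * (1 - a)" using assms by simp
  then have "0 < \<sigma>" using lt by linarith
  have "\<sigma> \<le> 1" unfolding \<sigma> by (rule four_mult_le_1)
  have w_lt: "w < 1/2" using lt \<open>0 < \<sigma>\<close> by (simp add: w)
  define c where "c = 1 / (1 - w)"
  have c: "sqrt_sing \<sigma> (catalan_fps (a * (1 - a))) c 0"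
    unfolding c_def using \<open>0 \<le> a * (1 - a)\<close> lt w by (rule catalan_fps_no_sing)
  have h: "sqrt_sing \<sigma> (min_return b) (1 / (2 * b)) (1 / (4 * b))"
    unfolding \<sigma> using assms by (intro min_return_sing) auto
  have w': "sqrt_sing \<sigma> (first_return (a * (1 - a))) w 0"
    unfolding w using \<open>0 \<le> a * (1 - a)\<close> lt by (rule first_return_no_sing)
  have b: "b < 1" "0 < b" using assms by auto
  \<comment> \<open>This bounds a c, so that the singular coefficient of the numerator, a multiple
    of 1 - a c, is nonzero.\<close>
  have "0 \<le> c" "c \<le> 2" using w_lt by (auto simp: c_def field_simps)
  then have ac: "a * c < 1" using assms mult_mono[of a a c 2] by linarith
  let ?d = "- (a * (1 / (4 * b) * c + 0 * (1 / (2 * b)))) * (1 - b / (1 - b) * (1 / (2 * b)))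
      - b / (1 - b) * (1 / (4 * b)) * (1 - a * (1 / (2 * b) * c))"
  have "?d = - (1 - a * c) / (4 * (1 - b))"
    using b by (simp add: divide_simps) (simp add: algebra_simps)
  then have d: "?d \<noteq> 0" using ac b by auto
  \<comment> \<open>For b >= 1/2 one has H(1) = (1 - b) / b, so the second factor vanishes.\<close>
  have zero: "(1 - a * ((1 - b) / max b (1 - b) * (1 / max a (1 - a))))
               * (1 - b / (1 - b) * ((1 - b) / max b (1 - b))) = 0"
    using assms b by (simp add: max_def)
  have "0 \<le> b" "a \<le> 1" using assms by auto
  from return_prob_limit[OF \<open>0 \<le> b\<close> b(1) assms(1) \<open>a \<le> 1\<close> \<open>0 < \<sigma>\<close> \<open>\<sigma> \<le> 1\<close> zero c h w' refl d, of k]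
  show "(\<lambda>n. return_prob a b n k) \<longlonglongrightarrow> (1 - w) * w ^ k"
    by (simp add: mult.commute)
qed

text \<open>Now P has the nearer singularity and H is regular there. The first-return series has
  value 1/2 and singular coefficient 1/4, so the correction term survives and brings in the factor k
  - 1.\<close>

lemma return_prob_limit_sqrt_a:
  assumes "1/2 \<le> a" "0 \<le> b" "b < 1/2" "a + b < 1"
    and S: "S = sqrt ((a - b) * (1 - a - b) / (a * (1 - a)))"
  shows "(\<lambda>n. return_prob a b n k)
    \<longlonglongrightarrow> (1 + (1 - (1 - a) * (1 + S) / (1 - b)) * (real k - 1)) / 2 ^ (k + 1)"
proof -
  define \<sigma> where "\<sigma> = 4 * (a * (1 - a))"
  have a: "0 < a" "a < 1" using assms by auto
  then have x: "0 < a * (1 - a)" by simp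
  have diff: "a * (1 - a) - b * (1 - b) = (a - b) * (1 - a - b)" by (simp add: algebra_simps)
  have "0 < (a - b) * (1 - a - b)" using assms by (intro mult_pos_pos) auto
  with diff have lt: "4 * (b * (1 - b)) < \<sigma>" unfolding \<sigma>_def by linarith
  have \<sigma>: "0 < \<sigma>" "\<sigma> \<le> 1" using x four_mult_le_1[of a] by (simp_all add: \<sigma>_def)
  have S': "S = sqrt (1 - 4 * (b * (1 - b)) / \<sigma>)"
    unfolding S diff[symmetric] using a by (simp add: \<sigma>_def diff_divide_distrib)
  have S0: "0 < S" unfolding S using \<open>0 < (a - b) * (1 - a - b)\<close> x by simp
  have y0: "0 \<le> b * (1 - b)" using assms by simp
  then have S1: "S \<le> 1" unfolding S' using \<sigma> by simp
  have SS: "a * (1 - a) * S ^ 2 = (a - b) * (1 - a - b)"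
    unfolding S using \<open>0 < (a - b) * (1 - a - b)\<close> a by simp
  \<comment> \<open>the value \<open>(1 - S) / (2 * b)\<close>, rationalised so that \<open>b = 0\<close> is allowed\<close>
  define h where "h = (1 - b) / (2 * (a * (1 - a)) * (1 + S))"
  have h0: "0 < h"
    unfolding h_def using assms(3,4) a x S0 by (intro divide_pos_pos mult_pos_pos) auto
  have bh: "b * h = (1 - S) / 2"
  proof -
    have "b * (1 - b) = a * (1 - a) * (1 - S ^ 2)" using SS diff by (simp add: algebra_simps)
    also have "\<dots> = a * (1 - a) * (1 + S) * (1 - S)" by (simp add: power2_eq_square algebra_simps)
    finally have "b * h = (a * (1 - a) * (1 + S)) * (1 - S) / (2 * (a * (1 - a) * (1 + S)))"
      by (simp add: h_def mult.assoc)
    also have "\<dots> = (1 - S) / 2"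
    proof -
      have "k * u / (2 * k) = u / 2" if "0 < k" for k u :: real using that by simp
      moreover have "0 < a * (1 - a) * (1 + S)" using x S0 by simp
      ultimately show ?thesis by blast
    qed
    finally show ?thesis .
  qed
  have h: "sqrt_sing \<sigma> (min_return b) h 0"
  proof (cases "b = 0")
    case True
    have "catalan_fps 0 = 1" using catalan_fps_eq[of 0] by simp
    then have "min_return b = fps_X" by (simp add: True min_return_def)
    moreover have "h = 1 / \<sigma>" using bh by (simp add: h_def \<sigma>_def True)
    ultimately show ?thesis by (simp add: sqrt_sing_X)
  next
    case False
    have "sqrt_sing \<sigma> (first_return (b * (1 - b))) (b * h) 0"
      unfolding bh S' using y0 lt by (rule first_return_no_sing)
    from sqrt_sing_cmult[OF \<sigma>(1) this, of "1 / b"]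
    show ?thesis using False by (simp add: first_return_min_return flip: mult.assoc)
  qed
  have c: "sqrt_sing \<sigma> (catalan_fps (a * (1 - a))) 2 1"
    unfolding \<sigma>_def using x by (rule catalan_fps_sing)
  have w: "sqrt_sing \<sigma> (first_return (a * (1 - a))) (1/2) (1/4)"
    unfolding \<sigma>_def using x by (rule first_return_sing)
  \<comment> \<open>Here H(1) = 1 and P(1) = 1 / a, so it is the first factor that vanishes.\<close>
  have zero: "(1 - a * ((1 - b) / max b (1 - b) * (1 / max a (1 - a))))
               * (1 - b / (1 - b) * ((1 - b) / max b (1 - b))) = 0"
    using assms(1-4) a by (simp add: max_def)
  define g where "g = 1 - b / (1 - b) * h"
  \<comment> \<open>Since S > 0, b h lies below 1/2, and 1/2 < 1 - b.\<close>
  have "b * h < 1 - b" using bh S0 assms(3) by (simp add: field_simps)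
  then have g: "0 < g" using assms(3) by (simp add: g_def field_simps)
  let ?d = "- (a * (0 * 2 + 1 * h)) * (1 - b / (1 - b) * h) - b / (1 - b) * 0 * (1 - a * (h * 2))"
  have d_eq: "?d = - (a * h * g)" by (simp add: g_def)
  then have d: "?d \<noteq> 0" using a h0 g by simp
  have "b < 1" "0 \<le> a" "a \<le> 1" using assms(3) a by auto
  from return_prob_limit[OF assms(2) this \<sigma> zero c h w refl d, of k]
  have "(\<lambda>n. return_prob a b n k) \<longlonglongrightarrow> (1/2) ^ k * (1 - 1/2)
      + (real k - 1) / (2 * 2 ^ (k + 1)) * ((1 - a * (h * 2)) * g) / (- (a * h * g))"
    unfolding half_power_derivative d_eq unfolding g_def .
  moreover have "(1/2) ^ k * (1 - 1/2)
      + (real k - 1) / (2 * 2 ^ (k + 1)) * ((1 - a * (h * 2)) * g) / (- (a * h * g))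
      = (1 + (1 - 1 / (2 * a * h)) * (real k - 1)) / 2 ^ (k + 1)"
    using a h0 g by (simp add: power_one_over divide_simps) (simp add: algebra_simps)
  moreover have "1 / (2 * a * h) = (1 - a) * (1 + S) / (1 - b)"
    using a S0 \<open>b < 1\<close> by (simp add: h_def divide_simps)
  ultimately show ?thesis by simp
qed

text \<open>The coefficients of E = P are exactly the comparison sequence, so the singular
  coefficient of the product is itself the limit of the quotient.\<close>

lemma return_prob_limit_classical:
  assumes "a + b = 1" "0 < a" "a < 1"
  shows "(\<lambda>n. return_prob a b n k) \<longlonglongrightarrow> real k / 2 ^ (k + 1)"
proof -
  let ?x = "a * (1 - a)"
  let ?V = "first_return ?x ^ k * (1 - first_return ?x)"
  have x: "0 < ?x" using assms by simp
  then have \<sigma>: "0 < 4 * ?x" by simp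
  have c: "sqrt_sing (4 * ?x) (catalan_fps ?x) 2 1" using x by (rule catalan_fps_sing)
  have "sqrt_sing (4 * ?x) (?V * catalan_fps ?x) ((1/2) ^ k * (1 - 1/2) * 2)
      ((real k - 1) / (2 * 2 ^ (k + 1)) * 2 + 1 * ((1/2) ^ k * (1 - 1/2)))"
    unfolding half_power_derivative[symmetric]
    by (intro sqrt_sing_mult returns_sing first_return_sing \<sigma> x c)
  then have "(\<lambda>n. fps_nth (?V * catalan_fps ?x) n / ((4 * ?x) ^ n * catal n))
      \<longlonglongrightarrow> (real k - 1) / (2 * 2 ^ (k + 1)) * 2 + 1 * ((1/2) ^ k * (1 - 1/2))"
    by (simp only: sqrt_sing_def)
  moreover have "(real k - 1) / (2 * 2 ^ (k + 1)) * 2 + 1 * ((1/2) ^ k * (1 - 1/2)) = real k / 2 ^ (k + 1)"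
    by (simp add: power_one_over divide_simps)
  moreover have "return_prob a b n k = fps_nth (?V * catalan_fps ?x) n / ((4 * ?x) ^ n * catal n)" for n
    unfolding return_prob_def excursion_gf_classical[OF assms(1)] by (simp add: catalan_fps_def)
  ultimately show ?thesis by simp
qed

section \<open>From z back to t: the generating functions of the walks\<close>

abbreviation sq_arg :: "real fps \<Rightarrow> real fps" where
  "sq_arg f \<equiv> f oo fps_X ^ 2"

lemma sq_arg_nth: "fps_nth (sq_arg f) n = (if even n then fps_nth f (n div 2) else 0)"
proof -
  have "fps_nth (sq_arg f) n = (\<Sum>i=0..n. if 2 * i = n then fps_nth f i else 0)"
    by (auto simp: fps_compose_nth simp flip: power_mult intro!: sum.cong)
  also have "\<dots> = (if even n then fps_nth f (n div 2) else 0)"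
  proof (cases "even n")
    case True
    then have "(2 * i = n) = (n div 2 = i)" for i by auto
    then show ?thesis using True by (simp add: sum.delta)
  next
    case False
    then have "2 * i \<noteq> n" for i by auto
    then show ?thesis using False by simp
  qed
  finally show ?thesis .
qed

lemma eval_fps_sq_arg:
  assumes "abs_sums_at (z ^ 2) f v"
  shows "eval_fps (sq_arg f) z = v"
proof -
  have "(\<lambda>n. fps_nth (sq_arg f) (2 * n) * z ^ (2 * n)) sums v"
    using assms by (simp add: abs_sums_at_def sq_arg_nth power_mult)
  moreover have "fps_nth (sq_arg f) n * z ^ n = 0" if "n \<notin> range ((*) 2)" for n
  proof -
    have "odd n" using that by (auto elim!: evenE)
    then show ?thesis by (simp add: sq_arg_nth)
  qed
  ultimately have "(\<lambda>n. fps_nth (sq_arg f) n * z ^ n) sums v"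
    by (subst sums_mono_reindex[of "(*) 2", symmetric]) (auto simp: strict_mono_def)
  then show ?thesis by (simp add: eval_fps_def sums_iff)
qed

context
  fixes p :: "int set \<Rightarrow> real" and a b :: real
  assumes sum_one: "p {-1} + p {1} + p {-1, 1} = 1"
    and a_def: "a = p {-1}" and b_def: "b = p {1}"
begin

lemma dyck_gf:
  "D00 p = sq_arg (catalan_fps (a * (1 - a)))"
  "D01 p = sq_arg (excursion_gf a b)"
  "fps_nth (F_gf p) k
   = sq_arg (first_return (a * (1 - a)) ^ k * (1 - first_return (a * (1 - a))) * excursion_gf a b)"
  "(\<Sum>s\<in>{s \<in> dyck_N_walks n. N_excursion s \<and> returns s = k}. weight p s)
   = fps_nth (fps_nth (F_gf p) k) n"
proof -
  have X0: "fps_nth ((fps_X :: real fps) ^ 2) 0 = 0" by simp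
  note compose = fps_compose_add_distrib fps_compose_sub_distrib fps_compose_mult_distrib[OF X0]
    fps_compose_power[OF X0, symmetric] fps_const_compose fps_compose_1
    fps_X_fps_compose_startby0[OF X0]
  define W where "W = sq_arg (first_return (a * (1 - a)))"
  define P where "P = sq_arg (catalan_fps (a * (1 - a)))"
  define B where "B = sq_arg (catalan_fps (b * (1 - b)))"
  define q where "q = fps_const (1 - a) * fps_X * P"
  define r where "r = fps_const b * fps_X * B"
  define G\<^sub>0 where "G\<^sub>0 = sq_arg (excursion_gf a b)"
  \<comment> \<open>Minimum 1 after the last departure from 0: any step from an excursion except the
    fatal one at \<open>{0}\<close> (hence the subtraction of a P), followed by a path of the
    minimum that stays at or above 1.\<close>
  define G\<^sub>1 where "G\<^sub>1 = fps_X * B * (G\<^sub>0 - fps_const a * P)"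
  have P: "P = 1 + fps_const a * fps_const (1 - a) * fps_X ^ 2 * P ^ 2"
    using arg_cong[OF catalan_fps_eq[of "a * (1 - a)"], of sq_arg]
    by (simp add: P_def compose)
  have B: "B = 1 + fps_const b * fps_const (1 - b) * fps_X ^ 2 * B ^ 2"
    using arg_cong[OF catalan_fps_eq[of "b * (1 - b)"], of sq_arg]
    by (simp add: B_def compose)
  have H: "sq_arg (min_return b) = fps_const (1 - b) * fps_X ^ 2 * B"
    by (simp add: min_return_def B_def compose)
  have G0: "(1 - fps_const (1 - b) * fps_X ^ 2 * B) * G\<^sub>0
      = 1 - fps_const a * (fps_const (1 - b) * fps_X ^ 2 * B * P)"
    using arg_cong[OF excursion_gf_eq[of b a], of sq_arg]
    by (simp add: G\<^sub>0_def P_def H compose)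
  have W: "W = fps_const a * fps_const (1 - a) * fps_X ^ 2 * P"
    by (simp add: W_def P_def first_return_def compose)
  have W0: "fps_nth W 0 = 0" by (simp add: W mult.assoc power2_eq_square)
  have q_eq: "q = fps_const (1 - p {-1}) * fps_X + fps_const (p {-1}) * fps_X * q ^ 2"
  proof -
    have "c = 1 + u * v * X ^ 2 * c ^ 2 \<Longrightarrow> v * X * c = v * X + u * X * (v * X * c) ^ 2"
      for c u v X :: "real fps" by algebra
    from this[OF P] show ?thesis unfolding q_def a_def .
  qed
  have r_eq: "r = fps_const (p {1}) * fps_X + fps_const (1 - p {1}) * fps_X * r ^ 2"
  proof -
    have "c = 1 + u * v * X ^ 2 * c ^ 2 \<Longrightarrow> u * X * c = u * X + v * X * (u * X * c) ^ 2"
      for c u v X :: "real fps" by algebra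
    from this[OF B] show ?thesis unfolding r_def b_def .
  qed
  have Wq: "W = fps_const (p {-1}) * fps_X * q"
    unfolding W q_def a_def by (simp only: power2_eq_square mult_ac)
  have WP: "(1 - W) * P = 1"
    using arg_cong[OF catalan_first_return[of "a * (1 - a)"], of sq_arg]
    by (simp add: W_def P_def compose)
  have G0_eq: "G\<^sub>0 = 1 + fps_const (1 - p {1}) * fps_X * G\<^sub>1"
  proof -
    have "(1 - v * X ^ 2 * c) * g = 1 - u * (v * X ^ 2 * c * d) \<Longrightarrow> g = 1 + v * X * (X * c * (g - u * d))"
      for c d g u v X :: "real fps" by algebra
    from this[OF G0] show ?thesis unfolding G\<^sub>1_def b_def .
  qed
  have G1_eq: "G\<^sub>1 = fps_X * (G\<^sub>0 - fps_const (p {-1}) * P)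
      + fps_const (1 - p {1}) * fps_X * (G\<^sub>1 * r)"
  proof -
    have "c = 1 + u * v * X ^ 2 * c ^ 2 \<Longrightarrow> X * c * y = X * y + v * X * (X * c * y * (u * X * c))"
      for c u v X y :: "real fps" by algebra
    from this[OF B] show ?thesis unfolding G\<^sub>1_def r_def a_def b_def .
  qed
  note facts = sum_one W0 q_eq Wq WP G0_eq G1_eq r_eq
  show "D00 p = sq_arg (catalan_fps (a * (1 - a)))"
    unfolding D00_eq[OF facts] P_def ..
  show "D01 p = sq_arg (excursion_gf a b)"
    unfolding D01_eq[OF facts] G\<^sub>0_def ..
  show "fps_nth (F_gf p) k
      = sq_arg (first_return (a * (1 - a)) ^ k * (1 - first_return (a * (1 - a))) * excursion_gf a b)"
    unfolding F_gf_nth[OF facts] by (simp add: W_def G\<^sub>0_def compose)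
  show "(\<Sum>s\<in>{s \<in> dyck_N_walks n. N_excursion s \<and> returns s = k}. weight p s)
      = fps_nth (fps_nth (F_gf p) k) n"
    unfolding F_gf_nth[OF facts] excursions_by_returns[OF facts] ..
qed

end

section \<open>Existence of the distributions and conclusion\<close>

lemma pmf_of_sums:
  fixes f :: "nat \<Rightarrow> real"
  assumes "\<And>k. 0 \<le> f k" "f sums 1"
  obtains L where "\<And>k. pmf L k = f k"
proof -
  have "(\<integral>\<^sup>+ k. ennreal (f k) \<partial>count_space UNIV) = 1"
    using suminf_ennreal_eq[OF assms] by (simp add: nn_integral_count_space_nat)
  from pmf_embed_pmf[OF assms(1) this] show thesis using that by blast
qed

text \<open>The mixture, with weights 1 - c and c, of the geometric law 1 / 2^(k + 1) and the
  negative binomial law k / 2^(k + 1).\<close>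

lemma mixed_pmf:
  fixes c :: real
  assumes "0 \<le> c" "c \<le> 1"
  obtains L where "\<And>k. pmf L k = (1 + c * (real k - 1)) / 2 ^ (k + 1)"
proof -
  have nonneg: "0 \<le> (1 + c * (real k - 1)) / 2 ^ (k + 1)" for k
  proof (cases k)
    case (Suc m)
    then show ?thesis using assms by simp
  qed (use assms in simp)
  have "(\<lambda>k. (1 - c) / 2 * (1/2) ^ k + c / 2 * ((1/2) ^ k * real k))
      sums ((1 - c) / 2 * (1 / (1 - 1/2)) + c / 2 * ((1/2) / (1 - 1/2) ^ 2))"
    by (intro sums_add sums_mult geometric_sums geometric_sums_times_n) simp_all
  moreover have "(1 - c) / 2 * (1 / (1 - 1/2)) + c / 2 * ((1/2) / (1 - 1/2) ^ 2) = 1"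
    by (simp add: power2_eq_square diff_divide_distrib)
  moreover have "(1 - c) / 2 * (1/2) ^ k + c / 2 * ((1/2) ^ k * real k)
      = (1 + c * (real k - 1)) / 2 ^ (k + 1)" for k
    by (simp add: power_one_over field_simps)
  ultimately have "(\<lambda>k. (1 + c * (real k - 1)) / 2 ^ (k + 1)) sums 1" by simp
  from pmf_of_sums[OF nonneg this] show thesis using that by blast
qed

lemma returns_le_length: "returns s \<le> length s"
proof -
  have "returns s \<le> card {1..length s}"
    unfolding returns_def by (rule card_mono) (simp, blast)
  then show ?thesis by simp
qed

text \<open>Grouping the excursions of length n by their number of returns, which is at most n,
  shows that the masses add up to 1.\<close>

lemma ex_returns_pmf:
  assumes nonneg: "p {-1} \<ge> 0" "p {1} \<ge> 0" "p {-1, 1} \<ge> 0"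
    and sum_one: "p {-1} + p {1} + p {-1, 1} = 1"
    and nz: "fps_nth (D01 p) n \<noteq> 0"
  shows "\<exists>Y. \<forall>k. pmf Y k = fps_nth (fps_nth (F_gf p) k) n / fps_nth (D01 p) n"
proof -
  let ?E = "{s \<in> dyck_N_walks n. N_excursion s}"
  let ?c = "\<lambda>k. \<Sum>s\<in>{s \<in> dyck_N_walks n. N_excursion s \<and> returns s = k}. weight p s"
  have F: "fps_nth (fps_nth (F_gf p) k) n = ?c k" for k
    using dyck_gf(4)[OF sum_one refl refl] by simp
  have w: "0 \<le> weight p s" if "s \<in> dyck_N_walks n" for s
    unfolding weight_def using that nonneg
    by (intro prod_list_nonneg) (auto simp: dyck_N_walks_def)
  have c0: "0 \<le> ?c k" for k by (intro sum_nonneg) (simp add: w)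
  have D: "fps_nth (D01 p) n = (\<Sum>s\<in>?E. weight p s)" by (simp add: D01_def)
  have D0: "0 < fps_nth (D01 p) n"
  proof -
    have "0 \<le> fps_nth (D01 p) n" unfolding D by (intro sum_nonneg) (simp add: w)
    then show ?thesis using nz by simp
  qed
  have le: "returns s \<le> n" if "s \<in> ?E" for s
    using that returns_le_length[of s] by (simp add: dyck_N_walks_def)
  have "(\<Sum>k\<le>n. \<Sum>s\<in>{s \<in> ?E. returns s = k}. weight p s) = (\<Sum>s\<in>?E. weight p s)"
    using le by (intro sum.group) auto
  then have total: "(\<Sum>k\<le>n. ?c k / fps_nth (D01 p) n) = 1"
    using D0 by (simp add: D conj_assoc flip: sum_divide_distrib)
  have "?c k / fps_nth (D01 p) n = 0" if "k \<notin> {..n}" for k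
  proof -
    have empty: "{s \<in> dyck_N_walks n. N_excursion s \<and> returns s = k} = {}"
      using that le by auto
    show ?thesis unfolding empty by simp
  qed
  then have "(\<lambda>k. ?c k / fps_nth (D01 p) n) sums 1"
    using sums_finite[of "{..n}" "\<lambda>k. ?c k / fps_nth (D01 p) n"] total by simp
  then show ?thesis
    unfolding F using c0 D0 by (elim pmf_of_sums[rotated]) auto
qed

theorem theorem2p19:
  fixes p :: "int set \<Rightarrow> real"
  assumes nonneg: "p {-1} \<ge> 0" "p {1} \<ge> 0" "p {-1, 1} \<ge> 0"
    and sum_one: "p {-1} + p {1} + p {-1, 1} = 1"
    and Y_well_defined: "\<And>n. fps_nth (D01 p) (2 * n) \<noteq> 0"
  shows "(\<forall>n k. fps_nth (fps_nth (F_gf p) k) n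
             = (\<Sum>s \<in> {s \<in> dyck_N_walks n. N_excursion s \<and> returns s = k}. weight p s)) \<and>
    (\<exists>(Y :: nat \<Rightarrow> nat pmf) (L :: nat pmf).
      (\<forall>n k. pmf (Y n) k = fps_nth (fps_nth (F_gf p) k) (2 * n) / fps_nth (D01 p) (2 * n)) \<and>
      (\<forall>k. (\<lambda>n. pmf (Y n) k) \<longlonglongrightarrow> pmf L k) \<and>
      (0 \<le> p {1} \<and> p {1} \<le> p {-1} \<and> p {-1} < 1/2 \<longrightarrow>
         (\<forall>k. pmf L k = 1 / eval_fps (D00 p) 1 * (1 - 1 / eval_fps (D00 p) 1) ^ k)) \<and>
      (0 \<le> p {-1} \<and> p {-1} < 1/2 \<and> p {1} = 1/2 \<longrightarrow>
         (\<forall>k. pmf L k = (1 - p {-1}) * p {-1} ^ k)) \<and>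
      (0 \<le> p {1} \<and> p {1} < 1/2 \<and> p {-1} = 1/2 \<longrightarrow>
         (\<forall>k. pmf L k = 1 / 2 ^ (k + 1))) \<and>
      (p {1} + p {-1} = 1 \<longrightarrow>
         (\<forall>k. pmf L k = real k / 2 ^ (k + 1))) \<and>
      (0 \<le> p {-1} \<and> p {-1} < 1/2 \<and> 1/2 < p {1} \<and> p {1} < 1 \<and> p {-1} + p {1} < 1 \<longrightarrow>
         (\<forall>k. pmf L k = 1 / eval_fps (D00 p) (sqrt (\<rho>\<^sub>2 p))
                         * (1 - 1 / eval_fps (D00 p) (sqrt (\<rho>\<^sub>2 p))) ^ k)) \<and>
      (0 \<le> p {1} \<and> p {1} < 1/2 \<and> 1/2 < p {-1} \<and> p {-1} < 1 \<and> p {-1} + p {1} < 1 \<longrightarrow>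
         \<eta> p \<in> {0..1} \<and>
         (\<forall>k. pmf L k = (1 + \<eta> p * (real k - 1)) / 2 ^ (k + 1))))"
proof -
  define a b where "a = p {-1}" and "b = p {1}"
  note gf = dyck_gf[OF sum_one a_def b_def]
  have ab: "0 \<le> a" "0 \<le> b" "a + b \<le> 1" using nonneg sum_one by (simp_all add: a_def b_def)
  have nondeg: "a \<noteq> 1" "b \<noteq> 1"
  proof -
    \<comment> \<open>If a or b were 1, only one of the steps \<open>{-1}\<close> and
      \<open>{1}\<close> would have positive weight. Excursions of length 2 would then have total
      weight 0, contradicting \<open>Y_well_defined\<close>.\<close>
    have "\<not> (a + b = 1 \<and> a * (1 - a) = 0)"
    proof
      assume *: "a + b = 1 \<and> a * (1 - a) = 0"
      then have "excursion_gf a b = 1"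
        using excursion_gf_classical[of a b] catalan_fps_eq[of 0]
        by (simp only: *) simp
      then have "fps_nth (D01 p) (2 * 1) = 0" by (simp add: gf(2) sq_arg_nth)
      then show False using Y_well_defined by blast
    qed
    then show "a \<noteq> 1" "b \<noteq> 1" using ab by auto
  qed
  have lt1: "a < 1" "b < 1" using nondeg ab by auto
  have "\<exists>Y. \<forall>n k. pmf (Y n) k = fps_nth (fps_nth (F_gf p) k) (2 * n) / fps_nth (D01 p) (2 * n)"
    using ex_returns_pmf[OF nonneg sum_one Y_well_defined] by (intro choice allI)
  then obtain Y where Y:
    "\<And>n k. pmf (Y n) k = fps_nth (fps_nth (F_gf p) k) (2 * n) / fps_nth (D01 p) (2 * n)"
    by blast
  have Y_lim: "(\<lambda>n. pmf (Y n) k) = (\<lambda>n. return_prob a b n k)" for k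
    by (simp add: Y gf(2,3) sq_arg_nth return_prob_def)
  let ?lim = "\<lambda>L. \<forall>k. (\<lambda>n. return_prob a b n k) \<longlonglongrightarrow> pmf L k"
  have geometric: "pmf (geometric_pmf (1 - w)) k = (1 - w) * w ^ k" if "0 \<le> w" "w < 1" for w k
    using that by simp
  \<comment> \<open>If a and b are both at least 1/2, then a + b = 1. The boundary values b = 1/2
    and a = 1/2 below the line a + b = 1 belong to the two square-root cases, with
    \<open>\<sigma>\<close> = 1.\<close>
  consider (pole) "a < 1/2" "b < 1/2" | (b) "a < 1/2" "1/2 \<le> b" "a + b < 1"
    | (a) "1/2 \<le> a" "b < 1/2" "a + b < 1" | (classical) "a + b = 1"
    using ab by fastforce
  then have "\<exists>L. ?lim L \<and>
      (b \<le> a \<and> a < 1/2 \<longrightarrow>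
         (\<forall>k. pmf L k = 1 / eval_fps (D00 p) 1 * (1 - 1 / eval_fps (D00 p) 1) ^ k)) \<and>
      (a < 1/2 \<and> b = 1/2 \<longrightarrow> (\<forall>k. pmf L k = (1 - a) * a ^ k)) \<and>
      (b < 1/2 \<and> a = 1/2 \<longrightarrow> (\<forall>k. pmf L k = 1 / 2 ^ (k + 1))) \<and>
      (b + a = 1 \<longrightarrow> (\<forall>k. pmf L k = real k / 2 ^ (k + 1))) \<and>
      (a < 1/2 \<and> 1/2 < b \<and> a + b < 1 \<longrightarrow>
         (\<forall>k. pmf L k = 1 / eval_fps (D00 p) (sqrt (\<rho>\<^sub>2 p))
                         * (1 - 1 / eval_fps (D00 p) (sqrt (\<rho>\<^sub>2 p))) ^ k)) \<and>
      (b < 1/2 \<and> 1/2 < a \<and> a + b < 1 \<longrightarrow>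
         \<eta> p \<in> {0..1} \<and> (\<forall>k. pmf L k = (1 + \<eta> p * (real k - 1)) / 2 ^ (k + 1)))"
    (is "\<exists>L. ?Q L")
  proof cases
    case pole
    have "abs_sums_at (1 ^ 2) (catalan_fps (a * (1 - a))) (1 / (1 - a))"
      using catalan_fps_sums_at_1[of a] ab pole by (simp add: max_def)
    then have ev: "eval_fps (D00 p) 1 = 1 / (1 - a)"
      unfolding gf(1) by (rule eval_fps_sq_arg)
    have "?Q (geometric_pmf (1 - a))"
      using return_prob_limit_pole[OF ab(1) pole(1) ab(2) pole(2)] geometric[of a] ab pole
      by (simp add: ev mult.commute)
    then show ?thesis by (rule exI[of ?Q])
  next
    case b
    define \<sigma> where "\<sigma> = 4 * (b * (1 - b))"
    define w where "w = (1 - sqrt (1 - 4 * (a * (1 - a)) / \<sigma>)) / 2"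
    note lim = return_prob_limit_sqrt_b[OF ab(1) b \<sigma>_def w_def]
    have x0: "0 \<le> a * (1 - a)" using ab lt1 by simp
    then have \<sigma>: "0 < \<sigma>" using lim(1) by linarith
    have w01: "0 \<le> w" "w < 1"
    proof -
      define u where "u = sqrt (1 - 4 * (a * (1 - a)) / \<sigma>)"
      have "0 \<le> u" "u \<le> 1" using x0 lim(1) \<sigma> by (simp_all add: u_def)
      then show "0 \<le> w" "w < 1" by (simp_all add: w_def flip: u_def)
    qed
    have "abs_sums_at (sqrt (\<rho>\<^sub>2 p) ^ 2) (catalan_fps (a * (1 - a))) (1 / (1 - w))"
    proof -
      have "sqrt (\<rho>\<^sub>2 p) ^ 2 = 1 / \<sigma>"
        using \<sigma> by (simp add: \<rho>\<^sub>2_def \<sigma>_def b_def mult.assoc)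
      then show ?thesis
        using catalan_fps_no_sing[OF x0 lim(1) w_def] by (simp add: sqrt_sing_def)
    qed
    then have ev: "eval_fps (D00 p) (sqrt (\<rho>\<^sub>2 p)) = 1 / (1 - w)"
      unfolding gf(1) by (rule eval_fps_sq_arg)
    have wa: "w = a" if "b = 1/2"
    proof -
      have "\<sigma> = 1" by (simp add: \<sigma>_def that)
      then show ?thesis using sqrt_one_minus_four[of a] b(1) by (simp add: w_def)
    qed
    obtain L where L: "\<And>k. pmf L k = (1 - w) * w ^ k"
      using geometric[OF w01] by blast
    have "?Q L"
      using lim(2) b wa by (simp add: ev L)
    then show ?thesis by (rule exI[of ?Q])
  next
    case a
    define S where "S = sqrt ((a - b) * (1 - a - b) / (a * (1 - a)))"
    define c where "c = 1 - (1 - a) * (1 + S) / (1 - b)"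
    have pos: "0 < (a - b) * (1 - a - b)" using a by (intro mult_pos_pos) auto
    have x: "0 < a * (1 - a)" using a lt1 by simp
    have S0: "0 \<le> S" unfolding S_def using pos x by simp
    have S2: "S ^ 2 = (a - b) * (1 - a - b) / (a * (1 - a))"
      unfolding S_def using pos x by (intro real_sqrt_pow2) (auto intro: divide_nonneg_pos)
    have "S \<le> (a - b) / (1 - a)"
    proof (rule power2_le_imp_le)
      \<comment> \<open>The bound on S is equivalent to c >= 0; after squaring and cancelling a - b
        it reduces to this sign.\<close>
      have "(1 - 2 * a) * (1 - b) \<le> 0" using a lt1 by (intro mult_nonpos_nonneg) auto
      then have "(1 - a - b) * (1 - a) \<le> (a - b) * a" by (simp add: algebra_simps)
      then have "(a - b) * ((1 - a - b) * (1 - a)) \<le> (a - b) * ((a - b) * a)"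
        using a by (intro mult_left_mono) auto
      then have "(a - b) * (1 - a - b) \<le> (a - b) * ((a - b) * a) / (1 - a)"
        using lt1 by (simp add: pos_le_divide_eq mult.assoc)
      then have "S ^ 2 \<le> (a - b) * ((a - b) * a) / (1 - a) / (a * (1 - a))"
        unfolding S2 using x by (intro divide_right_mono) auto
      also have "\<dots> = ((a - b) / (1 - a)) ^ 2"
        using a by (simp add: power2_eq_square)
      finally show "S ^ 2 \<le> ((a - b) / (1 - a)) ^ 2" .
      show "0 \<le> (a - b) / (1 - a)" using a lt1 by simp
    qed
    then have c01: "0 \<le> c" "c \<le> 1"
      using lt1 S0 mult_left_le[of a S] by (simp_all add: c_def field_simps)
    have eta: "\<eta> p = c"
    proof -
      have "sqrt (a * (1 - a) * (1 - b - a) * (a - b)) = a * (1 - a) * S"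
      proof (rule real_sqrt_unique)
        have "(a * (1 - a) * S)\<^sup>2 = a * (1 - a) * (a * (1 - a) * S\<^sup>2)"
          by (simp add: power2_eq_square mult_ac)
        also have "a * (1 - a) * S\<^sup>2 = (a - b) * (1 - a - b)"
          unfolding S2 using a lt1 by simp
        finally show "(a * (1 - a) * S)\<^sup>2 = a * (1 - a) * (1 - b - a) * (a - b)"
          by (simp add: algebra_simps)
        show "0 \<le> a * (1 - a) * S" using x S0 by simp
      qed
      then have "\<eta> p = (a * (a - b) - a * (1 - a) * S) / (a * (1 - b))"
        by (simp add: \<eta>_def a_def b_def)
      also have "\<dots> = c" using a lt1 by (simp add: c_def field_simps)
      finally show ?thesis .
    qed
    \<comment> \<open>At a = 1/2 one gets S = 1 - 2b, the mixture degenerates, and the geometric law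
      of the third case appears.\<close>
    have c0: "c = 0" if "a = 1/2"
    proof -
      have "S = sqrt ((1 - 2 * b) ^ 2)"
        unfolding S_def that by (rule arg_cong[of _ _ sqrt]) (simp add: power2_eq_square algebra_simps)
      then have "S = 1 - 2 * b" using a by simp
      then show ?thesis using lt1 by (simp add: c_def that field_simps)
    qed
    obtain L where L: "\<And>k. pmf L k = (1 + c * (real k - 1)) / 2 ^ (k + 1)"
      using mixed_pmf c01 by blast
    have "?Q L"
      using return_prob_limit_sqrt_a[OF a(1) ab(2) a(2,3) S_def] a c01 c0
      by (simp add: L eta c_def[symmetric])
    then show ?thesis by (rule exI[of ?Q])
  next
    case classical
    obtain L where L: "\<And>k. pmf L k = (1 + 1 * (real k - 1)) / 2 ^ (k + 1)"
      using mixed_pmf[of 1] by auto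
    have "0 < a" using classical lt1 by simp
    then have "?Q L"
      using return_prob_limit_classical[OF classical _ lt1(1)] classical by (simp add: L)
    then show ?thesis by (rule exI[of ?Q])
  qed
  then obtain L where "?Q L" by (rule exE[of ?Q])
  moreover from this have "\<forall>k. (\<lambda>n. pmf (Y n) k) \<longlonglongrightarrow> pmf L k"
    unfolding Y_lim by (rule conjunct1)
  ultimately show ?thesis
    using gf(4) Y by (intro conjI exI[of _ Y] exI[of _ L]) (simp_all add: a_def b_def)
qed

end
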